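(* For $\#\in\{0,1\}$ let $\mathsf b_L^{(\#)}=V^{-(1+\#)/2}\mathbf 1_{I_L^d}$ and define the order parameters via the local path measures $\mu_{{\rm tot},L}$ by $$\mathsf o^{(\#)}=\lim_{L\to\infty}\,i\,\mathbb E_{\mu_{{\rm tot},L}}\!\left[\frac{1}{i-\phi(j_0\mathsf b_L^{(\#)})}\right]\in[0,1].$$ The following are equivalent: (1) Bose–Einstein condensation occurs (the zero mode is meaningful), i.e. $\rho_0(\beta)>0$; (2) $\mathsf o^{(0)}=0$; (3) $\mathsf o^{(1)}<1$.
   Context: $d=3$, $s\ge1$, $h(k)=|k|^s$, $\beta>0$, $\bar\rho>0$. For $L>0$: $I_L=[-L/2,L/2]$, $V=L^d$, $\Gamma_L^d=(\frac{2\pi}L\mathbb Z)^d$; for $f\in L^2(I_L^d)$, $f_k=(2\pi)^{-d/2}\int_{I_L^d}e^{-ik\cdot x}f(x)dx$. Fixed density: for $y>1$ ($y=e^{-\beta\mu}$, chemical potential $\mu<0$) let $\rho_V(\beta,y)=\frac1V\sum_{k\in\Gamma_L^d}(ye^{\beta h(k)}-1)^{-1}$ and let $y_V>1$ be the unique solution of $\rho_V(\beta,y_V)=\bar\rho$, $y_V=e^{-\beta\mu_V}$. Condensate density: $\rho_0(\beta)=\lim_{V\to\infty}\frac1V\frac1{y_V-1}=\max(\bar\rho-\rho_c(\beta),0)$, $\rho_c(\beta)=(2\pi)^{-d}\int(e^{\beta h(k)}-1)^{-1}dk$. $\mu_{{\rm tot},L}$ is the centered Gaussian ($\beta$-Markov)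 path measure of the free Bose gas in the box $I_L^d$ at inverse temperature $\beta$ and density $\bar\rho$; $\phi(j_0f)$ denotes the time-zero field ($f\in L^2(I_L^d)$ real), a centered Gaussian random variable, linear in $f$, with $\mathbb E_{\mu_{{\rm tot},L}}[e^{i\phi(j_0f)}]=\exp(-\frac14q_L(f))$, $q_L(f)=\frac{(2\pi)^d}V\sum_{k\in\Gamma_L^d}\frac{1+e^{-\beta(h(k)-\mu_V)}}{1-e^{-\beta(h(k)-\mu_V)}}|f_k|^2$.
   Formalization: The implication from (2) to (1) is claimed only when the density differs from the critical density; at equality (possible for s<3) the condensate density is 0 yet o^(0)=0, so the equivalence with (2) fails there. Everything else, including (1) iff (3), is unconditional. *)

theory Defs
  imports "HOL-Probability.Probability"
begin

definition I_box :: "real \<Rightarrow> (real ^ 3) set" where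
  "I_box L = cbox (vec (- L / 2)) (vec (L / 2))"

definition vol :: "real \<Rightarrow> real" where
  "vol L = L ^ 3"

definition dual_lattice :: "real \<Rightarrow> (real ^ 3) set" where
  "dual_lattice L = {k. \<forall>i. \<exists>n::int. k $ i = 2 * pi / L * of_int n}"

definition dispersion :: "real \<Rightarrow> real ^ 3 \<Rightarrow> real" where
  "dispersion s k = norm k powr s"

definition fourier_coeff :: "real \<Rightarrow> (real ^ 3 \<Rightarrow> real) \<Rightarrow> real ^ 3 \<Rightarrow> complex" where
  "fourier_coeff L f k =
     complex_of_real ((2 * pi) powr (- 3 / 2)) *
     (LINT x:I_box L|lborel. exp (- \<i> * complex_of_real (k \<bullet> x)) * complex_of_real (f x))"

text \<open>Real elements of \<open>L\<^sup>2\<close> of the box, as Borel representatives; the values outside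
  the box are irrelevant throughout.\<close>

definition L2_box :: "real \<Rightarrow> (real ^ 3 \<Rightarrow> real) set" where
  "L2_box L = {f. set_borel_measurable lborel (I_box L) f \<and>
                  set_integrable lborel (I_box L) (\<lambda>x. (f x)\<^sup>2)}"

definition density :: "real \<Rightarrow> real \<Rightarrow> real \<Rightarrow> real \<Rightarrow> real" where
  "density \<beta> s L y =
     1 / vol L * (\<Sum>\<^sub>\<infinity>k\<in>dual_lattice L. 1 / (y * exp (\<beta> * dispersion s k) - 1))"

definition y_box :: "real \<Rightarrow> real \<Rightarrow> real \<Rightarrow> real \<Rightarrow> real" where
  "y_box \<beta> s \<rho> L = (THE y. y > 1 \<and> density \<beta> s L y = \<rho>)"

definition chem_pot :: "real \<Rightarrow> real \<Rightarrow> real \<Rightarrow> real \<Rightarrow> real" where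
  "chem_pot \<beta> s \<rho> L = - ln (y_box \<beta> s \<rho> L) / \<beta>"

definition condensate_density :: "real \<Rightarrow> real \<Rightarrow> real \<Rightarrow> real" where
  "condensate_density \<beta> s \<rho> = Lim at_top (\<lambda>L. 1 / vol L * (1 / (y_box \<beta> s \<rho> L - 1)))"

text \<open>The critical density is infinite when \<open>s \<ge> 3\<close>, hence the type \<^typ>\<open>ennreal\<close>.
  It is needed because at \<open>\<rho> = critical_density \<beta> s\<close> one has \<open>y_box \<beta> s \<rho> L \<longlongrightarrow> 1\<close>,
  so the order parameter of \<open>b_test 0\<close> vanishes, although the condensate density is zero.\<close>

definition critical_density :: "real \<Rightarrow> real \<Rightarrow> ennreal" where
  "critical_density \<beta> s =
     ennreal (1 / (2 * pi) ^ 3) *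
     (\<integral>\<^sup>+k. ennreal (1 / (exp (\<beta> * dispersion s k) - 1)) \<partial>(lborel :: (real ^ 3) measure))"

definition cov_form :: "real \<Rightarrow> real \<Rightarrow> real \<Rightarrow> real \<Rightarrow> (real ^ 3 \<Rightarrow> real) \<Rightarrow> real" where
  "cov_form \<beta> s \<rho> L f =
     (2 * pi) ^ 3 / vol L *
     (\<Sum>\<^sub>\<infinity>k\<in>dual_lattice L.
        (1 + exp (- \<beta> * (dispersion s k - chem_pot \<beta> s \<rho> L))) /
        (1 - exp (- \<beta> * (dispersion s k - chem_pot \<beta> s \<rho> L))) *
        (cmod (fourier_coeff L f k))\<^sup>2)"

text \<open>Here \<open>M\<close> is the path measure of the free Bose gas in the box of side \<open>L\<close>, and
  \<open>\<phi> f\<close> is the time-zero field usually written \<open>\<phi>(j\<^sub>0 f)\<close>. The characteristic function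
  says that \<open>\<phi> f\<close> is a centered Gaussian with variance \<open>cov_form \<beta> s \<rho> L f / 2\<close>;
  together with linearity this fixes the joint law of the field. Linearity holds up to null
  sets, the null set being allowed to depend on the test functions and scalars.\<close>

locale time_zero_field = prob_space M
  for M :: "'w measure" +
  fixes \<beta> s \<rho> L :: real and \<phi> :: "(real ^ 3 \<Rightarrow> real) \<Rightarrow> 'w \<Rightarrow> real"
  assumes field_measurable: "f \<in> L2_box L \<Longrightarrow> random_variable borel (\<phi> f)"
    and field_linear: "f \<in> L2_box L \<Longrightarrow> g \<in> L2_box L \<Longrightarrow>
          AE \<omega> in M. \<phi> (\<lambda>x. a * f x + b * g x) \<omega> = a * \<phi> f \<omega> + b * \<phi> g \<omega>"
    and field_char: "f \<in> L2_box L \<Longrightarrow>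
          expectation (\<lambda>\<omega>. exp (\<i> * complex_of_real (\<phi> f \<omega>))) =
          complex_of_real (exp (- cov_form \<beta> s \<rho> L f / 4))"

definition b_test :: "nat \<Rightarrow> real \<Rightarrow> real ^ 3 \<Rightarrow> real" where
  "b_test j L x = vol L powr (- (1 + real j) / 2) * indicator (I_box L) x"

definition order_fun ::
    "'w measure \<Rightarrow> ((real ^ 3 \<Rightarrow> real) \<Rightarrow> 'w \<Rightarrow> real) \<Rightarrow> nat \<Rightarrow> real \<Rightarrow> complex" where
  "order_fun M \<phi> j L =
     \<i> * integral\<^sup>L M (\<lambda>\<omega>. 1 / (\<i> - complex_of_real (\<phi> (b_test j L) \<omega>)))"

end

theory Submission
  imports Defs "HOL-Real_Asymp.Real_Asymp"
begin

text \<open>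
  The test functions \<open>b_test j L\<close> see only the zero mode, so the field is a centered Gaussian
  with characteristic exponent \<open>q / 4\<close>, \<open>q = V\<^sup>-\<^sup>j (y + 1) / (y - 1)\<close> with \<open>y = y_box \<beta> s \<rho> L\<close>.
  Writing \<open>\<i> / (\<i> - x)\<close> as the Laplace integral of \<open>exp (- t - \<i> t x)\<close> over \<open>t > 0\<close> and exchanging
  integrals, the order parameter at finite \<open>L\<close> becomes \<open>G q\<close>, where \<open>G q\<close> is the integral of
  \<open>exp (- t - q t\<^sup>2 / 4)\<close>; here \<open>G\<close> is continuous, \<open>G 0 = 1\<close>, \<open>0 < G q < 1\<close> for \<open>q > 0\<close>, and
  \<open>G q\<close> tends to \<open>0\<close> as \<open>q\<close> tends to infinity.

  For \<open>j = 1\<close> the exponent converges to twice the condensate density; for \<open>j = 0\<close> it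
  is governed by the limit of \<open>y\<close>. Both limits come from the lattice sum of the occupation
  numbers: split off the zero mode and read the rest as the integral of the occupation
  number composed with rounding to the lattice. Off the central cell rounding shrinks
  norms by at most a factor 5/2, so dominated convergence applies, even to the singular
  integrand at \<open>y = 1\<close> whenever the critical density is finite.
\<close>

section \<open>The zero mode\<close>

lemma integrable_lborel_prod:
  fixes f :: "'a::euclidean_space \<Rightarrow> real \<Rightarrow> 'b::{real_normed_field,banach,second_countable_topology}"
  assumes "\<And>b. b \<in> Basis \<Longrightarrow> integrable lborel (f b)"
  shows "integrable lborel (\<lambda>x::'a. \<Prod>b\<in>Basis. f b (x \<bullet> b))"
proof -
  interpret product_sigma_finite "\<lambda>_::'a. lborel :: real measure"
    by standard
  have [measurable]: "f b \<in> borel_measurable borel" if "b \<in> Basis" for b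
    using borel_measurable_integrable[OF assms[OF that]] by simp
  have "integrable (\<Pi>\<^sub>M b\<in>Basis. lborel) (\<lambda>x. \<Prod>b\<in>(Basis::'a set). f b (x b))"
    using assms by (intro product_integrable_prod) auto
  then show ?thesis
    by (subst lborel_eq, subst integrable_distr_eq) (auto intro!: borel_measurable_prod)
qed

text \<open>\<open>lborel\<close> is the image of the product measure indexed by
  \<open>Basis\<close>, so this is Fubini for finite products. The codomain is general because plane
  waves are complex-valued.\<close>

lemma integral_lborel_prod:
  fixes f :: "'a::euclidean_space \<Rightarrow> real \<Rightarrow> 'b::{real_normed_field,banach,second_countable_topology}"
  assumes "\<And>b. b \<in> Basis \<Longrightarrow> integrable lborel (f b)"
  shows "(\<integral>x. (\<Prod>b\<in>Basis. f b (x \<bullet> b)) \<partial>lborel) = (\<Prod>b\<in>Basis. \<integral>t. f b t \<partial>lborel)"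
proof -
  interpret product_sigma_finite "\<lambda>_::'a. lborel :: real measure"
    by standard
  have [measurable]: "f b \<in> borel_measurable borel" if "b \<in> Basis" for b
    using borel_measurable_integrable[OF assms[OF that]] by simp
  have "(\<integral>x. (\<Prod>b\<in>Basis. f b (x \<bullet> b)) \<partial>(lborel::'a measure)) =
     (\<integral>y. (\<Prod>b\<in>Basis. f b (y b)) \<partial>(\<Pi>\<^sub>M b\<in>Basis. lborel))"
    by (subst lborel_eq, subst integral_distr)
       (auto intro!: borel_measurable_prod measurable_compose[OF _ borel_measurable_integrable, OF _ assms])
  also have "\<dots> = (\<Prod>b\<in>Basis. \<integral>t. f b t \<partial>lborel)"
    using assms by (intro product_integral_prod) auto
  finally show ?thesis .
qed

section \<open>Plane waves on the box and the covariance of its indicator\<close>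

lemma integrable_exp_linear_Icc:
  "integrable lborel (\<lambda>t. indicator {-c..c} t *\<^sub>R exp (- (\<i> * complex_of_real (a * t))))"
proof -
  have "set_integrable lborel {-c..c} (\<lambda>t. exp (- (\<i> * complex_of_real (a * t))))"
    by (intro borel_integrable_atLeastAtMost' continuous_intros)
  then show ?thesis
    by (simp add: set_integrable_def)
qed

text \<open>Integration over a whole number of periods: the antiderivative takes the same value at
  both endpoints.\<close>

lemma integral_exp_period:
  fixes L :: real and n :: int
  assumes "L > 0" "n \<noteq> 0"
  shows "(\<integral>t. indicator {- L/2..L/2} t *\<^sub>R
            exp (- (\<i> * complex_of_real (2 * pi / L * n * t))) \<partial>lborel) = 0"
proof -
  define a where "a = 2 * pi / L * n"
  have a: "a \<noteq> 0" using assms by (simp add: a_def)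
  define F where "F t = exp (- (\<i> * complex_of_real (a * t))) / (- (\<i> * complex_of_real a))" for t
  have "(F has_vector_derivative exp (- (\<i> * complex_of_real (a * t)))) (at t within {- L/2..L/2})" for t
  proof -
    have "((\<lambda>z. exp (- (\<i> * (complex_of_real a * z))) / (- (\<i> * complex_of_real a)))
      has_field_derivative exp (- (\<i> * (complex_of_real a * complex_of_real t)))) (at (complex_of_real t))"
      using a by (auto intro!: derivative_eq_intros simp: algebra_simps)
    from has_vector_derivative_real_field[OF this] show ?thesis
      by (simp add: F_def[abs_def])
  qed
  then have "(\<integral>t. indicator {- L/2..L/2} t *\<^sub>R exp (- (\<i> * complex_of_real (a * t))) \<partial>lborel)
      = F (L/2) - F (- L/2)"
    using assms by (intro integral_FTC_Icc) (auto intro!: continuous_intros)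
  also have "F (L/2) = F (- L/2)"
  proof -
    have *: "a * (L/2) = pi * n" "a * (- L/2) = - (pi * n)"
      using assms by (auto simp: a_def)
    \<comment> \<open>The cosines agree by parity, and both sines vanish because \<open>n\<close> is
      an integer.\<close>
    have "exp (- (\<i> * complex_of_real (pi * n))) = exp (- (\<i> * complex_of_real (- (pi * n))))"
      unfolding complex_eq_iff by (simp add: Re_exp Im_exp)
    then show ?thesis
      unfolding F_def * by (simp only:)
  qed
  finally show ?thesis by (simp add: a_def)
qed

lemma indicator_I_box: "indicat_real (I_box L) x = (\<Prod>b\<in>Basis. indicator {- L/2..L/2} (x \<bullet> b))"
proof -
  have "x \<in> I_box L \<longleftrightarrow> (\<forall>b\<in>Basis. x \<bullet> b \<in> {- L/2..L/2})"
    by (auto simp: I_box_def mem_box Basis_vec_def inner_axis)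
  then show ?thesis
    by (cases "x \<in> I_box L") (auto simp: indicator_def prod_zero_iff simp del: atLeastAtMost_iff)
qed

text \<open>The integral factors over coordinates. A nonzero lattice vector has a nonzero
  coordinate, and the factor belonging to it vanishes by periodicity.\<close>

lemma fourier_coeff_const:
  assumes "L > 0" "k \<in> dual_lattice L"
  shows "fourier_coeff L (\<lambda>x. c * indicator (I_box L) x) k =
    (if k = 0 then complex_of_real ((2 * pi) powr (- 3 / 2) * c * vol L) else 0)"
proof -
  let ?f = "\<lambda>b t. indicator {- L/2..L/2} t *\<^sub>R exp (- (\<i> * complex_of_real ((k \<bullet> b) * t)))"
  have "(LINT x:I_box L|lborel. exp (- \<i> * complex_of_real (k \<bullet> x)) * complex_of_real (c * indicator (I_box L) x))
     = (\<integral>x. c * (\<Prod>b\<in>Basis. ?f b (x \<bullet> b)) \<partial>lborel)"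
    unfolding set_lebesgue_integral_def
  proof (intro Bochner_Integration.integral_cong refl)
    fix x :: "real ^ 3"
    have e: "exp (- \<i> * complex_of_real (k \<bullet> x)) = (\<Prod>b\<in>Basis. exp (- (\<i> * complex_of_real ((k \<bullet> b) * (x \<bullet> b)))))"
      by (subst euclidean_inner) (simp add: exp_sum[symmetric] sum_distrib_left sum_negf)
    have "(\<Prod>b\<in>Basis. ?f b (x \<bullet> b)) = complex_of_real (indicator (I_box L) x) * exp (- \<i> * complex_of_real (k \<bullet> x))"
      unfolding e indicator_I_box of_real_prod by (simp only: scaleR_conv_of_real prod.distrib)
    then show "indicator (I_box L) x *\<^sub>R (exp (- \<i> * complex_of_real (k \<bullet> x)) * complex_of_real (c * indicator (I_box L) x))
      = c * (\<Prod>b\<in>Basis. ?f b (x \<bullet> b))"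
      by (cases "x \<in> I_box L") simp_all
  qed
  also have "\<dots> = c * (\<Prod>b\<in>Basis. \<integral>t. ?f b t \<partial>lborel)"
    using integrable_exp_linear_Icc[of "L/2"]
    by (subst integral_mult_right_zero, subst integral_lborel_prod) auto
  also have "(\<Prod>b\<in>Basis. \<integral>t. ?f b t \<partial>lborel) = (if k = 0 then complex_of_real (vol L) else 0)"
  proof (cases "k = 0")
    case True
    have "(\<integral>t. ?f b t \<partial>lborel) = complex_of_real L" for b
      using assms True by (simp add: scaleR_conv_of_real)
    with True show ?thesis by (simp add: vol_def)
  next
    case False
    then obtain i where i: "k $ i \<noteq> 0" by (auto simp: vec_eq_iff)
    obtain n :: int where n: "k $ i = 2 * pi / L * n"
      using assms by (auto simp: dual_lattice_def)
    have "n \<noteq> 0" using i n by auto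
    then have "(\<integral>t. ?f (axis i 1) t \<partial>lborel) = 0"
      using integral_exp_period[OF assms(1), of n] by (simp add: inner_axis n)
    then have "(\<Prod>b\<in>Basis. \<integral>t. ?f b t \<partial>lborel) = 0"
      by (intro prod_zero bexI[of _ "axis i 1"]) (auto simp: Basis_vec_def)
    with False show ?thesis by simp
  qed
  finally show ?thesis
    unfolding fourier_coeff_def by simp
qed

text \<open>Only \<open>k = 0\<close> survives in the sum. The powers of \<open>2 * pi\<close>
  cancel, and what remains is the hyperbolic cotangent factor of the zero mode in terms of
  \<open>y\<close>.\<close>

lemma cov_form_const:
  assumes "L > 0" "\<beta> > 0" "y_box \<beta> s \<rho> L > 1"
  defines "y \<equiv> y_box \<beta> s \<rho> L"
  shows "cov_form \<beta> s \<rho> L (\<lambda>x. c * indicator (I_box L) x) = c\<^sup>2 * vol L * ((y + 1) / (y - 1))"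
proof -
  have V: "vol L > 0" using assms by (simp add: vol_def)
  have 0: "0 \<in> dual_lattice L"
    by (auto simp: dual_lattice_def intro: exI[of _ 0])
  have y: "y > 1" using assms by simp
  have sq: "((2 * pi) powr (- 3 / 2))\<^sup>2 = 1 / (2 * pi) ^ 3"
  proof -
    have "((2 * pi) powr (- 3 / 2))\<^sup>2 = (2 * pi) powr (- 3 / 2 + - 3 / 2)"
      unfolding power2_eq_square powr_add ..
    also have "\<dots> = (2 * pi) powr (- 3)" by simp
    also have "\<dots> = 1 / (2 * pi) powr 3" by (rule powr_minus_divide)
    also have "(2 * pi) powr 3 = (2 * pi) ^ 3" by (rule powr_numeral) simp
    finally show ?thesis .
  qed
  \<comment> \<open>Since \<open>0 powr s = 0\<close>, the exponent is \<beta> times the chemical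
    potential, that is \<open>- ln y\<close>.\<close>
  have e: "exp (- \<beta> * (dispersion s 0 - chem_pot \<beta> s \<rho> L)) = 1 / y"
    using assms(2) y by (simp add: dispersion_def chem_pot_def exp_minus y_def inverse_eq_divide)
  have "cov_form \<beta> s \<rho> L (\<lambda>x. c * indicator (I_box L) x) =
    (2 * pi) ^ 3 / vol L * (\<Sum>\<^sub>\<infinity>k\<in>{0}. (1 + exp (- \<beta> * (dispersion s k - chem_pot \<beta> s \<rho> L))) /
        (1 - exp (- \<beta> * (dispersion s k - chem_pot \<beta> s \<rho> L))) *
        (cmod (fourier_coeff L (\<lambda>x. c * indicator (I_box L) x) k))\<^sup>2)"
    unfolding cov_form_def
    by (intro arg_cong2[where f="(*)"] refl infsum_cong_neutral)
       (use 0 assms(1) in \<open>auto simp: fourier_coeff_const\<close>)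
  also have "\<dots> = (2 * pi) ^ 3 / vol L * ((1 + 1/y) / (1 - 1/y) * ((2 * pi) powr (- 3 / 2) * c * vol L)\<^sup>2)"
    using 0 assms(1) by (simp add: fourier_coeff_const e[simplified] del: of_real_mult)
  also have "\<dots> = c\<^sup>2 * vol L * ((1 + 1/y) / (1 - 1/y))"
  proof -
    have "P / v * (r * (1 / P * c\<^sup>2 * v\<^sup>2)) = c\<^sup>2 * v * r" if "P > 0" "v > 0" for P v r :: real
      using that by (simp add: power2_eq_square)
    note * = this[of "2 ^ 3 * pi ^ 3", OF _ V]
    show ?thesis
      unfolding power_mult_distrib sq by (rule *) simp
  qed
  also have "(1 + 1/y) / (1 - 1/y) = (y + 1) / (y - 1)"
    using y by (simp add: field_simps)
  finally show ?thesis .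
qed

section \<open>The order parameter as a Laplace integral\<close>

text \<open>Fundamental theorem of calculus on the half-line. As \<open>Re a = 1\<close>, the
  integrand has modulus \<open>exp (- t)\<close>, which gives both integrability and decay of the
  antiderivative at infinity.\<close>

lemma complex_laplace_transform_one:
  fixes x :: real
  shows "(\<integral>t. indicator {0<..} t *\<^sub>R exp (- ((1 + \<i> * complex_of_real x) * complex_of_real t)) \<partial>lborel)
    = 1 / (1 + \<i> * complex_of_real x)"
proof -
  define a where "a = 1 + \<i> * complex_of_real x"
  have a: "Re a = 1" "a \<noteq> 0" by (auto simp: a_def complex_eq_iff)
  define F where "F t = - exp (- (a * complex_of_real t)) / a" for t
  have norm: "cmod (exp (- (a * complex_of_real t))) = exp (- t)" for t
    using a by (simp add: norm_exp_eq_Re)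
  have "(LBINT t=0..\<infinity>. exp (- (a * complex_of_real t))) = 0 - F 0"
  proof (rule interval_integral_FTC_integrable)
    show "(F has_vector_derivative exp (- (a * complex_of_real t))) (at t)" for t
    proof -
      have "((\<lambda>z. - exp (- (a * z)) / a) has_field_derivative exp (- (a * complex_of_real t))) (at (complex_of_real t))"
        using a by (auto intro!: derivative_eq_intros)
      from has_vector_derivative_real_field[OF this] show ?thesis
        by (simp add: F_def[abs_def])
    qed
    show "set_integrable lborel (einterval 0 \<infinity>) (\<lambda>t. exp (- (a * complex_of_real t)))"
    proof -
      have "set_integrable lborel {0<..} (\<lambda>t. exp (- (a * complex_of_real t)))"
        using integrable_I0i_exp_mscale[of 1] unfolding set_integrable_def
        by (rule Bochner_Integration.integrable_bound) (auto simp: norm indicator_def a)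
      then show ?thesis
        by (simp add: zero_ereal_def)
    qed
    have "isCont F 0"
      unfolding F_def using a by (intro continuous_intros) auto
    then have "(F \<longlongrightarrow> F 0) (at_right 0)"
      by (simp add: isCont_def filterlim_at_split)
    then show "((F \<circ> real_of_ereal) \<longlongrightarrow> F 0) (at_right 0)"
      by (simp add: zero_ereal_def ereal_tendsto_simps)
    have "((\<lambda>t. exp (- t) / cmod a) \<longlongrightarrow> 0) at_top"
      using a by real_asymp
    then have "(F \<longlongrightarrow> 0) at_top"
      by (intro tendsto_norm_zero_cancel[of F]) (simp add: F_def[abs_def] norm norm_divide del: norm_exp_eq_Re)
    then show "((F \<circ> real_of_ereal) \<longlongrightarrow> 0) (at_left \<infinity>)"
      by (simp add: ereal_tendsto_simps)
  qed (auto intro!: continuous_intros)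
  also have "(LBINT t=0..\<infinity>. exp (- (a * complex_of_real t)))
      = (\<integral>t. indicator {0<..} t *\<^sub>R exp (- (a * complex_of_real t)) \<partial>lborel)"
    by (simp add: interval_lebesgue_integral_0_infty set_lebesgue_integral_def)
  also have "0 - F 0 = 1 / a"
    by (simp add: F_def)
  finally show ?thesis
    unfolding a_def .
qed

text \<open>For \<open>q > 0\<close> this is \<open>sqrt (pi / q) * exp (1 / q)\<close> times the
  complementary error function at \<open>1 / sqrt q\<close>. It is also the mean of
  \<open>1 / (1 + X^2)\<close> for a centered Gaussian \<open>X\<close> of variance
  \<open>q / 2\<close>.\<close>

definition gauss_resolvent :: "real \<Rightarrow> real" where
  "gauss_resolvent q = (\<integral>t. indicator {0<..} t * exp (- t - q * t\<^sup>2 / 4) \<partial>lborel)"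

lemma integrable_exp_pos: "integrable lborel (\<lambda>t::real. indicator {0<..} t * exp (- t))"
  using integrable_I0i_exp_mscale[of 1] by (simp add: set_integrable_def)

lemma integrable_gauss_resolvent:
  "q \<ge> 0 \<Longrightarrow> integrable lborel (\<lambda>t::real. indicator {0<..} t * exp (- t - q * t\<^sup>2 / 4))"
  by (rule Bochner_Integration.integrable_bound[OF integrable_exp_pos]) (auto simp: indicator_def)

lemma gauss_resolvent_0: "gauss_resolvent 0 = 1"
  using LBINT_I0i_exp_mscale[of 1]
  by (simp add: gauss_resolvent_def interval_lebesgue_integral_0_infty set_lebesgue_integral_def)

lemma gauss_resolvent_nonneg: "gauss_resolvent q \<ge> 0"
  unfolding gauss_resolvent_def by (rule Bochner_Integration.integral_nonneg) simp

lemma gauss_resolvent_le_1: "q \<ge> 0 \<Longrightarrow> gauss_resolvent q \<le> 1"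
  unfolding gauss_resolvent_0[symmetric] unfolding gauss_resolvent_def
  using integrable_gauss_resolvent[of q] integrable_gauss_resolvent[of 0]
  by (intro integral_mono) (auto simp: indicator_def)

text \<open>A nonnegative integrand with vanishing integral is zero almost everywhere, which is
  impossible since \<open>{0<..<1}\<close> has positive measure.\<close>

lemma integral_indicator_pos_pos:
  fixes f :: "real \<Rightarrow> real"
  assumes "integrable lborel (\<lambda>t. indicator {0<..} t * f t)" "\<And>t. t > 0 \<Longrightarrow> f t > 0"
  shows "(\<integral>t. indicator {0<..} t * f t \<partial>lborel) > 0"
proof -
  have nn: "0 \<le> indicator {0<..} t * f t" for t
    using assms(2)[of t] by (auto simp: indicator_def)
  have "(\<integral>t. indicator {0<..} t * f t \<partial>lborel) \<noteq> 0"
  proof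
    assume "(\<integral>t. indicator {0<..} t * f t \<partial>lborel) = 0"
    then have "AE t in lborel. indicator {0<..} t * f t = 0"
      using integral_nonneg_eq_0_iff_AE[OF assms(1)] nn by simp
    then have "AE t in lborel. t \<notin> {0<..<1::real}"
      using assms(2) by (force simp: indicator_def)
    then have "emeasure lborel {0<..<1::real} = 0"
      by (subst (asm) AE_iff_measurable[of "{0<..<1::real}"]) auto
    then show False by simp
  qed
  then show ?thesis
    using Bochner_Integration.integral_nonneg[of lborel "\<lambda>t. indicator {0<..} t * f t"] nn by (simp add: order_less_le)
qed

lemma gauss_resolvent_pos: "q \<ge> 0 \<Longrightarrow> gauss_resolvent q > 0"
  unfolding gauss_resolvent_def
  by (rule integral_indicator_pos_pos[OF integrable_gauss_resolvent]) auto

text \<open>The deficit from 1 is the integral of a function that is strictly positive for all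
  \<open>t > 0\<close>. This strictness later detects the condensate through
  \<open>o1 < 1\<close>.\<close>

lemma gauss_resolvent_less_1:
  assumes "q > 0"
  shows "gauss_resolvent q < 1"
proof -
  have int: "integrable lborel (\<lambda>t. indicator {0<..} t * exp (- t) - indicator {0<..} t * exp (- t - q * t\<^sup>2 / 4))"
    using assms by (intro Bochner_Integration.integrable_diff integrable_exp_pos integrable_gauss_resolvent) simp
  have "1 - gauss_resolvent q = gauss_resolvent 0 - gauss_resolvent q"
    by (simp add: gauss_resolvent_0)
  also have "\<dots> = (\<integral>t. indicator {0<..} t * exp (- t) - indicator {0<..} t * exp (- t - q * t\<^sup>2 / 4) \<partial>lborel)"
    unfolding gauss_resolvent_def using assms integrable_exp_pos integrable_gauss_resolvent[of q]
    by (subst Bochner_Integration.integral_diff) auto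
  also have "\<dots> = (\<integral>t. indicator {0<..} t * (exp (- t) - exp (- t - q * t\<^sup>2 / 4)) \<partial>lborel)"
    by (simp add: right_diff_distrib)
  also have "\<dots> > 0"
    using assms int by (intro integral_indicator_pos_pos) (auto simp: right_diff_distrib)
  finally show ?thesis by simp
qed

lemma gauss_resolvent_tendsto:
  fixes q :: "real \<Rightarrow> real"
  assumes q: "(q \<longlongrightarrow> q0) at_top" and "eventually (\<lambda>x. q x \<ge> 0) at_top"
  shows "((\<lambda>x. gauss_resolvent (q x)) \<longlongrightarrow> gauss_resolvent q0) at_top"
  unfolding gauss_resolvent_def
proof (rule integral_dominated_convergence_at_top[OF _ _ integrable_exp_pos])
  show "AE t in lborel. ((\<lambda>x. indicator {0<..} t * exp (- t - q x * t\<^sup>2 / 4)) \<longlongrightarrow> indicator {0<..} t * exp (- t - q0 * t\<^sup>2 / 4)) at_top"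
    by (intro AE_I2 tendsto_intros q) auto
  show "\<forall>\<^sub>F x in at_top. AE t in lborel. norm (indicator {0<..} t * exp (- t - q x * t\<^sup>2 / 4)) \<le> indicator {0<..} t * exp (- t)"
    using assms(2) by eventually_elim (auto simp: indicator_def)
qed auto

lemma gauss_resolvent_tendsto_0:
  fixes q :: "real \<Rightarrow> real"
  assumes q: "filterlim q at_top at_top"
  shows "((\<lambda>x. gauss_resolvent (q x)) \<longlongrightarrow> 0) at_top"
proof -
  have "((\<lambda>x. gauss_resolvent (q x)) \<longlongrightarrow> (\<integral>t. 0 \<partial>(lborel :: real measure))) at_top"
    unfolding gauss_resolvent_def
  proof (rule integral_dominated_convergence_at_top[OF _ _ integrable_exp_pos])
    have "((\<lambda>x. indicator {0<..} t * exp (- t - q x * t\<^sup>2 / 4)) \<longlongrightarrow> 0) at_top" for t :: real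
    proof (cases "t > 0")
      case True
      have "((\<lambda>u. exp (- t - u * t\<^sup>2 / 4)) \<longlongrightarrow> 0) at_top"
        using True by real_asymp
      from filterlim_compose[OF this q] True show ?thesis by simp
    qed simp
    then show "AE t in lborel. ((\<lambda>x. indicator {0<..} t * exp (- t - q x * t\<^sup>2 / 4)) \<longlongrightarrow> 0) at_top"
      by simp
    show "\<forall>\<^sub>F x in at_top. AE t in lborel. norm (indicator {0<..} t * exp (- t - q x * t\<^sup>2 / 4)) \<le> indicator {0<..} t * exp (- t)"
      using filterlim_at_top[THEN iffD1, OF q, rule_format, of 0]
      by eventually_elim (auto simp: indicator_def)
  qed auto
  then show ?thesis by simp
qed

text \<open>The Laplace kernel has norm \<open>exp (- t)\<close> on \<open>t > 0\<close>,
  independent of the sample point. It is therefore integrable on the product with a probability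
  space, and Fubini applies whatever the law of \<open>X\<close>; only its characteristic function
  remains.\<close>

lemma (in prob_space) expectation_resolvent:
  assumes [measurable]: "random_variable borel X"
  shows "\<i> * expectation (\<lambda>\<omega>. 1 / (\<i> - complex_of_real (X \<omega>))) =
    (\<integral>t. indicator {0<..} t *\<^sub>R (exp (- complex_of_real t) * expectation (\<lambda>\<omega>. exp (\<i> * complex_of_real (- t * X \<omega>)))) \<partial>lborel)"
proof -
  interpret P: pair_sigma_finite M "lborel :: real measure" by standard
  define f where "f \<omega> t = indicator {0<..} t *\<^sub>R exp (- ((1 + \<i> * complex_of_real (X \<omega>)) * complex_of_real t))" for \<omega> t
  have meas [measurable]: "case_prod f \<in> borel_measurable (M \<Otimes>\<^sub>M lborel)"
    unfolding f_def split_beta' by measurable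
  have norm: "norm (f \<omega> t) = indicator {0<..} t * exp (- t)" for \<omega> t
    by (simp add: f_def norm_exp_eq_Re)
  have int_t: "integrable lborel (f \<omega>)" if "\<omega> \<in> space M" for \<omega>
    using integrable_exp_pos 
    by (rule Bochner_Integration.integrable_bound) (use that in \<open>auto simp: norm\<close>)
  have int: "integrable (M \<Otimes>\<^sub>M lborel) (case_prod f)"
    using int_t by (intro P.Fubini_integrable) (auto simp: norm)
  have "\<i> * expectation (\<lambda>\<omega>. 1 / (\<i> - complex_of_real (X \<omega>))) = expectation (\<lambda>\<omega>. 1 / (1 + \<i> * complex_of_real (X \<omega>)))"
  proof -
    have "\<i> * (1 / (\<i> - complex_of_real x)) = 1 / (1 + \<i> * complex_of_real x)" for x
    proof -
      have "\<i> - complex_of_real x \<noteq> 0" "1 + \<i> * complex_of_real x \<noteq> 0" by (auto simp: complex_eq_iff)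
      then show ?thesis by (simp add: field_simps)
    qed
    then show ?thesis
      by (simp flip: integral_mult_right_zero)
  qed
  also have "\<dots> = (\<integral>\<omega>. (\<integral>t. f \<omega> t \<partial>lborel) \<partial>M)"
    unfolding f_def complex_laplace_transform_one ..
  also have "\<dots> = (\<integral>t. (\<integral>\<omega>. f \<omega> t \<partial>M) \<partial>lborel)"
    by (rule P.Fubini_integral[OF int, symmetric])
  also have "\<dots> = (\<integral>t. indicator {0<..} t *\<^sub>R (exp (- complex_of_real t) * expectation (\<lambda>\<omega>. exp (\<i> * complex_of_real (- t * X \<omega>)))) \<partial>lborel)"
  proof (intro Bochner_Integration.integral_cong refl)
    fix t :: real
    have "f \<omega> t = (indicator {0<..} t *\<^sub>R exp (- complex_of_real t)) * exp (\<i> * complex_of_real (- t * X \<omega>))" for \<omega>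
      by (simp add: f_def scaleR_conv_of_real ring_distribs flip: exp_add) (simp add: ac_simps)
    then show "(\<integral>\<omega>. f \<omega> t \<partial>M) = indicator {0<..} t *\<^sub>R (exp (- complex_of_real t) * expectation (\<lambda>\<omega>. exp (\<i> * complex_of_real (- t * X \<omega>))))"
      by simp
  qed
  finally show ?thesis .
qed

section \<open>The field on multiples of the box indicator\<close>

lemma L2_box_const: "(\<lambda>x. c * indicator (I_box L) x) \<in> L2_box L"
proof -
  have *: "indicator (I_box L) x * (c * indicator (I_box L) x)\<^sup>2 = c\<^sup>2 * indicat_real (I_box L) x" for x
    by (simp add: indicator_def)
  have "integrable lborel (\<lambda>x. c\<^sup>2 * indicator (I_box L) x :: real)"
    by (intro integrable_mult_right integrable_real_indicator) (auto simp: I_box_def emeasure_lborel_cbox_eq)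
  moreover have "I_box L \<in> sets borel" by (simp add: I_box_def)
  ultimately show ?thesis
    unfolding L2_box_def mem_Collect_eq set_integrable_def set_borel_measurable_def real_scaleR_def * by simp
qed

lemma (in time_zero_field) order_fun_eq:
  assumes L: "L > 0" and \<beta>: "\<beta> > 0" and y: "y_box \<beta> s \<rho> L > 1"
  defines "y \<equiv> y_box \<beta> s \<rho> L"
  shows "order_fun M \<phi> j L = complex_of_real (gauss_resolvent (vol L powr (- real j) * ((y + 1) / (y - 1))))"
proof -
  define q where "q = vol L powr (- real j) * ((y + 1) / (y - 1))"
  have V: "vol L > 0" using L by (simp add: vol_def)
  have L2: "b_test j L \<in> L2_box L"
    unfolding b_test_def[abs_def] by (rule L2_box_const)
  have char: "expectation (\<lambda>\<omega>. exp (\<i> * complex_of_real (- t * \<phi> (b_test j L) \<omega>))) = complex_of_real (exp (- q * t\<^sup>2 / 4))" for t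
  proof -
    \<comment> \<open>\<open>field_char\<close> speaks of \<open>\<phi> f\<close> itself and not of
      its multiples, so the factor \<open>- t\<close> is moved into the test function. The second
      coefficient 0 specialises linearity to homogeneity.\<close>
    define g where "g = (\<lambda>x. - t * b_test j L x + 0 * b_test j L x)"
    have g: "g = (\<lambda>x. (- t * vol L powr (- (1 + real j) / 2)) * indicator (I_box L) x)"
      by (auto simp: g_def b_test_def fun_eq_iff)
    have gL2: "g \<in> L2_box L"
      unfolding g by (rule L2_box_const)
    have "expectation (\<lambda>\<omega>. exp (\<i> * complex_of_real (- t * \<phi> (b_test j L) \<omega>))) = expectation (\<lambda>\<omega>. exp (\<i> * complex_of_real (\<phi> g \<omega>)))"
    proof (rule integral_cong_AE)
      show "AE \<omega> in M. exp (\<i> * complex_of_real (- t * \<phi> (b_test j L) \<omega>)) = exp (\<i> * complex_of_real (\<phi> g \<omega>))"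
        using field_linear[OF L2 L2, of "- t" 0] unfolding g_def by eventually_elim simp
    qed (use field_measurable[OF L2] field_measurable[OF gL2] in measurable)
    also have "\<dots> = complex_of_real (exp (- cov_form \<beta> s \<rho> L g / 4))"
      by (rule field_char[OF gL2])
    also have "cov_form \<beta> s \<rho> L g = (- t * vol L powr (- (1 + real j) / 2))\<^sup>2 * vol L * ((y + 1) / (y - 1))"
      unfolding g y_def by (rule cov_form_const[OF L \<beta> y])
    also have "\<dots> = t\<^sup>2 * ((vol L powr (- (1 + real j) / 2))\<^sup>2 * vol L powr 1) * ((y + 1) / (y - 1))"
      using V by (simp add: power_mult_distrib)
    also have "(vol L powr (- (1 + real j) / 2))\<^sup>2 * vol L powr 1 = vol L powr (- real j)"
      unfolding power2_eq_square powr_add[symmetric] by (simp add: field_simps)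
    finally show ?thesis by (simp add: q_def mult_ac)
  qed
  have "order_fun M \<phi> j L = (\<integral>t. indicator {0<..} t *\<^sub>R (exp (- complex_of_real t) * complex_of_real (exp (- q * t\<^sup>2 / 4))) \<partial>lborel)"
    unfolding order_fun_def expectation_resolvent[OF field_measurable[OF L2]] char ..
  also have "\<dots> = (\<integral>t. complex_of_real (indicator {0<..} t * exp (- t - q * t\<^sup>2 / 4)) \<partial>lborel)"
  proof (intro Bochner_Integration.integral_cong refl)
    fix t :: real
    have "exp (- complex_of_real t) = complex_of_real (exp (- t))"
      by (simp flip: exp_of_real)
    moreover have "exp (- t - q * t\<^sup>2 / 4) = exp (- t) * exp (- q * t\<^sup>2 / 4)"
      by (simp flip: exp_add)
    ultimately show "indicator {0<..} t *\<^sub>R (exp (- complex_of_real t) * complex_of_real (exp (- q * t\<^sup>2 / 4))) =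
        complex_of_real (indicator {0<..} t * exp (- t - q * t\<^sup>2 / 4))"
      by (simp add: scaleR_conv_of_real)
  qed
  also have "\<dots> = complex_of_real (gauss_resolvent q)"
    unfolding gauss_resolvent_def by (rule integral_complex_of_real)
  finally show ?thesis by (simp add: q_def)
qed

section \<open>Lattice sums as integrals\<close>

definition grid :: "real \<Rightarrow> 'a::euclidean_space set" where
  "grid h = {k. \<forall>b\<in>Basis. \<exists>n::int. k \<bullet> b = h * of_int n}"

text \<open>Nearest lattice point, coordinate by coordinate. For \<open>h > 0\<close> the shift by
  \<open>1/2\<close> centers the half-open cells at the lattice points, so they tile the space
  without overlap.\<close>

definition grid_round :: "real \<Rightarrow> 'a::euclidean_space \<Rightarrow> 'a" where
  "grid_round h x = (\<Sum>b\<in>Basis. (h * of_int \<lfloor>x \<bullet> b / h + 1/2\<rfloor>) *\<^sub>R b)"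

lemma dual_lattice_eq_grid: "dual_lattice L = grid (2 * pi / L)"
  by (auto simp: dual_lattice_def grid_def Basis_vec_def inner_axis)

lemma grid_round_inner: "b \<in> Basis \<Longrightarrow> grid_round h x \<bullet> b = h * of_int \<lfloor>x \<bullet> b / h + 1/2\<rfloor>"
  by (simp add: grid_round_def)

lemma grid_round_in_grid: "grid_round h x \<in> grid h"
  by (auto simp: grid_def grid_round_inner)

lemma grid_round_eq_iff:
  assumes "h > 0" "k \<in> grid h"
  shows "grid_round h x = k \<longleftrightarrow> (\<forall>b\<in>Basis. k \<bullet> b - h/2 \<le> x \<bullet> b \<and> x \<bullet> b < k \<bullet> b + h/2)"
proof -
  have "h * of_int \<lfloor>x \<bullet> b / h + 1/2\<rfloor> = k \<bullet> b \<longleftrightarrow> k \<bullet> b - h/2 \<le> x \<bullet> b \<and> x \<bullet> b < k \<bullet> b + h/2"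
    if b: "b \<in> Basis" for b
  proof -
    obtain n :: int where n: "k \<bullet> b = h * of_int n" using assms b by (auto simp: grid_def)
    have "h * of_int \<lfloor>x \<bullet> b / h + 1/2\<rfloor> = k \<bullet> b \<longleftrightarrow> \<lfloor>x \<bullet> b / h + 1/2\<rfloor> = n"
      using assms by (simp add: n)
    also have "\<dots> \<longleftrightarrow> k \<bullet> b - h/2 \<le> x \<bullet> b \<and> x \<bullet> b < k \<bullet> b + h/2"
      using assms(1) by (auto simp: floor_eq_iff n field_simps)
    finally show ?thesis .
  qed
  then show ?thesis
    by (subst euclidean_eq_iff) (simp add: grid_round_inner)
qed

lemma norm_grid_round_diff:
  fixes x :: "'a::euclidean_space"
  assumes "h > 0"
  shows "norm (x - grid_round h x) \<le> real DIM('a) * h / 2"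
proof -
  have "\<bar>(x - grid_round h x) \<bullet> b\<bar> \<le> h / 2" if "b \<in> Basis" for b
  proof -
    have "grid_round h x \<bullet> b - h/2 \<le> x \<bullet> b \<and> x \<bullet> b < grid_round h x \<bullet> b + h/2"
      using grid_round_eq_iff[OF assms grid_round_in_grid, of x x] that by blast
    then show ?thesis
      unfolding inner_diff_left by arith
  qed
  then have "(\<Sum>b\<in>Basis. \<bar>(x - grid_round h x) \<bullet> b\<bar>) \<le> (\<Sum>b\<in>(Basis::'a set). h / 2)"
    by (intro sum_mono)
  then show ?thesis
    using norm_le_l1[of "x - grid_round h x"] by simp
qed

text \<open>A nonzero lattice point has norm at least \<open>h\<close>, so the rounding error, at
  most \<open>DIM * h / 2\<close>, is bounded by a multiple of that norm. In the central cell no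
  such bound is possible, which is why the zero mode is split off.\<close>

lemma norm_le_grid_round:
  fixes x :: "'a::euclidean_space"
  assumes "h > 0" "grid_round h x \<noteq> 0"
  shows "norm x \<le> (1 + real DIM('a) / 2) * norm (grid_round h x)"
proof -
  obtain b where b: "b \<in> Basis" "grid_round h x \<bullet> b \<noteq> 0"
    using assms(2) by (metis euclidean_all_zero_iff)
  have "h * 1 \<le> h * \<bar>real_of_int \<lfloor>x \<bullet> b / h + 1/2\<rfloor>\<bar>"
    using b assms by (intro mult_left_mono) (auto simp: grid_round_inner)
  also have "\<dots> = \<bar>grid_round h x \<bullet> b\<bar>"
    using b assms by (simp add: grid_round_inner abs_mult)
  also have "\<dots> \<le> norm (grid_round h x)"
    using b by (intro Basis_le_norm)
  finally have *: "real DIM('a) * h / 2 \<le> real DIM('a) / 2 * norm (grid_round h x)"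
    using mult_left_mono[of h "norm (grid_round h x)" "real DIM('a) / 2"] by simp
  then show ?thesis
    unfolding distrib_right
    using * norm_grid_round_diff[OF assms(1), of x] norm_triangle_sub[of x "grid_round h x"] by linarith
qed

section \<open>Counting measure on the lattice as an image of Lebesgue measure\<close>

lemma countable_grid: "countable (grid h :: 'a::euclidean_space set)"
proof -
  have "k \<in> (\<lambda>f. \<Sum>b\<in>Basis. (h * of_int (f b)) *\<^sub>R b) ` (Basis \<rightarrow>\<^sub>E (UNIV :: int set))"
    if "k \<in> grid h" for k :: 'a
  proof -
    from that obtain f where f: "\<And>b. b \<in> Basis \<Longrightarrow> k \<bullet> b = h * of_int (f b :: int)"
      unfolding grid_def mem_Collect_eq by metis
    have "k = (\<Sum>b\<in>Basis. (k \<bullet> b) *\<^sub>R b)" by (simp add: euclidean_representation)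
    also have "\<dots> = (\<Sum>b\<in>Basis. (h * of_int (restrict f Basis b)) *\<^sub>R b)"
      by (intro sum.cong) (simp_all add: f)
    finally show ?thesis
      by (intro image_eqI[of _ _ "restrict f Basis"]) auto
  qed
  then have "(grid h :: 'a set) \<subseteq> (\<lambda>f. \<Sum>b\<in>Basis. (h * of_int (f b)) *\<^sub>R b) ` (Basis \<rightarrow>\<^sub>E (UNIV :: int set))"
    by auto
  then show ?thesis
    by (rule countable_subset) (intro countable_image countable_PiE, auto)
qed

lemma borel_measurable_grid_round [measurable]: "grid_round h \<in> borel_measurable borel"
  unfolding grid_round_def[abs_def] by measurable

lemma measurable_grid_round: "grid_round h \<in> borel \<rightarrow>\<^sub>M count_space (grid h :: 'a::euclidean_space set)"
  by (subst measurable_count_space_eq_countable[OF countable_grid])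
     (auto simp: grid_round_in_grid intro!: measurable_sets_borel[OF borel_measurable_grid_round])

text \<open>The half-open cell lies between an open and a closed box of the same volume.\<close>

lemma emeasure_grid_cell:
  fixes k :: "'a::euclidean_space"
  assumes "h > 0" "k \<in> grid h"
  shows "emeasure lborel (grid_round h -` {k}) = ennreal (h ^ DIM('a))"
proof (rule antisym)
  let ?l = "k - (\<Sum>b\<in>Basis. (h/2) *\<^sub>R b)" and ?u = "k + (\<Sum>b\<in>Basis. (h/2) *\<^sub>R b)"
  have lu: "(?u - ?l) \<bullet> b = h" "?l \<bullet> b = k \<bullet> b - h/2" "?u \<bullet> b = k \<bullet> b + h/2" if "b \<in> Basis" for b
    using that by (simp_all add: inner_diff_left inner_add_left inner_sum_left inner_Basis if_distrib cong: if_cong)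
  have box: "box ?l ?u \<subseteq> grid_round h -` {k}" and cbox: "grid_round h -` {k} \<subseteq> cbox ?l ?u"
    by (auto simp: subset_eq vimage_singleton_eq grid_round_eq_iff[OF assms] mem_box lu(2,3) less_imp_le)
  have meas: "grid_round h -` {k} \<in> sets lborel"
    by (auto intro!: measurable_sets_borel[OF borel_measurable_grid_round])
  have vol: "(\<Prod>b\<in>Basis. (?u - ?l) \<bullet> b) = h ^ DIM('a)"
    by (subst prod.cong[OF refl lu(1)]) simp_all
  have le: "\<And>b. b \<in> Basis \<Longrightarrow> ?l \<bullet> b \<le> ?u \<bullet> b"
    using assms(1) by (simp only: lu)
  show "emeasure lborel (grid_round h -` {k}) \<le> ennreal (h ^ DIM('a))"
    using emeasure_mono[OF cbox, of lborel] emeasure_lborel_cbox[OF le] vol by simp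
  show "ennreal (h ^ DIM('a)) \<le> emeasure lborel (grid_round h -` {k})"
    using emeasure_mono[OF box meas] emeasure_lborel_box[OF le] vol by simp
qed

text \<open>Both measures live on a countable set, so it suffices to compare singletons, whose
  preimages are the cells.\<close>

lemma distr_grid_round:
  assumes "h > 0"
  shows "distr lborel (count_space (grid h)) (grid_round h) =
    Nonnegative_Lebesgue_Integration.density (count_space (grid h :: 'a::euclidean_space set)) (\<lambda>_. ennreal (h ^ DIM('a)))"
proof (rule measure_eqI_countable[of _ "grid h"])
  fix k :: 'a assume "k \<in> grid h"
  then show "emeasure (distr lborel (count_space (grid h)) (grid_round h)) {k} =
      emeasure (Nonnegative_Lebesgue_Integration.density (count_space (grid h)) (\<lambda>_. ennreal (h ^ DIM('a)))) {k}"
    using emeasure_grid_cell[OF assms, of k]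
    by (simp add: emeasure_distr measurable_grid_round emeasure_density nn_integral_cmult_indicator)
qed (auto simp: countable_grid)

text \<open>Change of variables along the rounding map. Integrability of the step function becomes
  absolute summability on the lattice, through which \<open>infsetsum\<close> is converted to
  \<open>infsum\<close>.\<close>

lemma grid_sum_eq_integral:
  fixes g :: "'a::euclidean_space \<Rightarrow> real"
  assumes "h > 0" "integrable lborel (\<lambda>x. g (grid_round h x))"
  shows "g summable_on grid h"
    and "h ^ DIM('a) * infsum g (grid h) = (\<integral>x. g (grid_round h x) \<partial>lborel)"
proof -
  have "integrable (distr lborel (count_space (grid h)) (grid_round h)) g"
    using assms by (subst integrable_distr_eq) (auto simp: measurable_grid_round)
  then have "integrable (count_space (grid h)) g"
    unfolding distr_grid_round[OF assms(1)] using assms(1) by (simp add: integrable_density)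
  then have abs: "Infinite_Set_Sum.abs_summable_on g (grid h)"
    by (simp add: abs_summable_on_def)
  then show "g summable_on grid h"
    by (simp add: abs_summable_equivalent[symmetric] abs_summable_summable)
  have "(\<integral>x. g (grid_round h x) \<partial>lborel) = integral\<^sup>L (distr lborel (count_space (grid h)) (grid_round h)) g"
    by (subst integral_distr) (auto simp: measurable_grid_round)
  also have "\<dots> = h ^ DIM('a) * infsetsum g (grid h)"
    unfolding distr_grid_round[OF assms(1)] infsetsum_def using assms(1) by (simp add: integral_density)
  finally show "h ^ DIM('a) * infsum g (grid h) = (\<integral>x. g (grid_round h x) \<partial>lborel)"
    by (simp add: infsetsum_infsum[OF abs])
qed

lemma grid_round_tendsto:
  fixes x :: "'a::euclidean_space"
  assumes "(h \<longlongrightarrow> 0) F" "eventually (\<lambda>L. h L > 0) F"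
  shows "((\<lambda>L. grid_round (h L) x) \<longlongrightarrow> x) F"
proof -
  have "((\<lambda>L. x - grid_round (h L) x) \<longlongrightarrow> 0) F"
  proof (rule Lim_null_comparison)
    show "\<forall>\<^sub>F L in F. norm (x - grid_round (h L) x) \<le> real DIM('a) * h L / 2"
      using assms(2) by eventually_elim (rule norm_grid_round_diff)
    show "((\<lambda>L. real DIM('a) * h L / 2) \<longlongrightarrow> 0) F"
      using tendsto_mult[OF tendsto_const[of "real DIM('a) / 2"] assms(1)] by simp
  qed
  from tendsto_diff[OF tendsto_const[of x] this] show ?thesis by simp
qed

text \<open>The two monotonicity conditions are inherited termwise from \<open>y \<mapsto> 1 / (y e - 1)\<close> with \<open>e \<ge> 1\<close>,
  and they survive summation and integration. Together they squeeze the profile between multiples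
  of its value at a nearby point, which gives continuity without any uniform convergence.\<close>

locale bose_profile =
  fixes D :: "real \<Rightarrow> real"
  assumes pos: "1 < y \<Longrightarrow> 0 < D y"
    and mult_antimono: "1 < x \<Longrightarrow> x \<le> y \<Longrightarrow> y * D y \<le> x * D x"
    and mult_mono: "1 < x \<Longrightarrow> x \<le> y \<Longrightarrow> (x - 1) * D x \<le> (y - 1) * D y"
begin

lemma strict_antimono:
  assumes "1 < x" "x < y"
  shows "D y < D x"
proof -
  have "y * D y \<le> x * D x" using assms by (intro mult_antimono) auto
  also have "\<dots> < y * D x" using assms pos by (intro mult_strict_right_mono) auto
  finally show ?thesis using assms by simp
qed

lemma continuous_on: "continuous_on {1<..} D"
proof (rule continuous_at_imp_continuous_on, safe)
  fix x :: real assume x: "1 < x"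
  let ?a = "\<lambda>y. x * D x / y" and ?b = "\<lambda>y. (x - 1) * D x / (y - 1)"
  have a: "(?a \<longlongrightarrow> D x) (at x)" and b: "(?b \<longlongrightarrow> D x) (at x)"
    using x by (auto intro!: tendsto_eq_intros)
  have "\<forall>\<^sub>F y in at x. y > 1"
    using x by (intro order_tendstoD(1)[OF tendsto_ident_at])
  \<comment> \<open>To the right of \<open>x\<close>, \<open>?a\<close> bounds from above and
    \<open>?b\<close> from below; to the left the roles are exchanged.\<close>
  then have ev: "\<forall>\<^sub>F y in at x. min (?a y) (?b y) \<le> D y \<and> D y \<le> max (?a y) (?b y)"
  proof eventually_elim
    case (elim y)
    show ?case
    proof (cases "x \<le> y")
      case True
      then show ?thesis
        using mult_antimono[of x y] mult_mono[of x y] x elim by (auto simp: field_simps min_le_iff_disj le_max_iff_disj)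
    next
      case False
      then show ?thesis
        using mult_antimono[of y x] mult_mono[of y x] x elim by (auto simp: field_simps min_le_iff_disj le_max_iff_disj)
    qed
  qed
  show "isCont D x"
    unfolding isCont_def
  proof (rule tendsto_sandwich)
    show "((\<lambda>y. min (?a y) (?b y)) \<longlongrightarrow> D x) (at x)" "((\<lambda>y. max (?a y) (?b y)) \<longlongrightarrow> D x) (at x)"
      using tendsto_min[OF a b] tendsto_max[OF a b] by simp_all
  qed (use ev in \<open>auto elim: eventually_mono\<close>)
qed

text \<open>Intermediate value theorem and strict monotonicity. The point \<open>a\<close> must be
  supplied because a profile can be bounded: the bulk density stays below the critical density,
  which may be finite.\<close>

lemma ex1_root:
  assumes "\<rho> > 0" "a > 1" "D a \<ge> \<rho>"
  shows "\<exists>!y. y > 1 \<and> D y = \<rho>"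
proof (rule ex_ex1I)
  \<comment> \<open>Chosen so that \<open>mult_antimono\<close> bounds \<open>D ?b\<close> by
    \<open>a * D a / ?b\<close>, which is \<rho>.\<close>
  let ?b = "a * D a / \<rho>"
  have ab: "a \<le> ?b"
    using assms by (simp add: field_simps)
  then have "?b * D ?b \<le> a * D a"
    using assms by (intro mult_antimono)
  moreover have "a * D a > 0" using assms by (intro mult_pos_pos) auto
  ultimately have "D ?b \<le> \<rho>"
    using assms by (simp add: field_simps)
  moreover have "continuous_on {a..?b} D"
    by (rule continuous_on_subset[OF continuous_on]) (use assms in auto)
  ultimately obtain y where "a \<le> y" "D y = \<rho>"
    using IVT2'[of D ?b \<rho> a] assms ab by auto
  then show "\<exists>y. y > 1 \<and> D y = \<rho>"
    using assms by (intro exI[of _ y]) auto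
next
  fix x y assume "x > 1 \<and> D x = \<rho>" "y > 1 \<and> D y = \<rho>"
  then show "x = y"
    using strict_antimono[of x y] strict_antimono[of y x] by (cases x y rule: linorder_cases) auto
qed

end

section \<open>Occupation numbers\<close>

text \<open>A dilation changes Lebesgue measure only by a constant factor. This makes dilated
  occupation numbers available as integrable majorants.\<close>

lemma integrable_scaleR:
  fixes f :: "'a::euclidean_space \<Rightarrow> real"
  assumes "integrable lborel f" "c \<noteq> 0"
  shows "integrable lborel (\<lambda>x. f (c *\<^sub>R x))"
proof -
  have [measurable]: "f \<in> borel_measurable borel"
    using borel_measurable_integrable[OF assms(1)] by simp
  have "integrable (Nonnegative_Lebesgue_Integration.density (distr lborel borel (\<lambda>x. 0 + c *\<^sub>R x)) (\<lambda>_. ennreal (\<bar>c\<bar> ^ DIM('a)))) f"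
    using assms lborel_affine[OF assms(2), of "0::'a"] by (simp add: ennreal_power)
  then show ?thesis
    using assms(2) by (simp add: integrable_density integrable_distr_eq)
qed

lemma integrable_exp_abs:
  assumes "a > 0"
  shows "integrable lborel (\<lambda>t::real. exp (- (a * \<bar>t\<bar>)))"
proof -
  have 1: "integrable lborel (\<lambda>t. indicator {0<..} t * exp (- (t * a)))"
    using integrable_I0i_exp_mscale[OF assms] by (simp add: set_integrable_def)
  have 2: "integrable lborel (\<lambda>t. indicator {0<..} (- t) * exp (- (- t * a)))"
    using lborel_integrable_real_affine[OF 1, of "-1" 0] by simp
  show ?thesis
  proof (rule Bochner_Integration.integrable_bound[OF Bochner_Integration.integrable_add[OF 1 2]])
    \<comment> \<open>Both indicators vanish at 0, so the bound fails at that single point.\<close>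
    show "AE t in lborel. norm (exp (- (a * \<bar>t\<bar>))) \<le> norm (indicator {0<..} t * exp (- (t * a)) + indicator {0<..} (- t) * exp (- (- t * a)))"
      using AE_lborel_singleton[of 0] by eventually_elim (auto simp: indicator_def abs_if mult.commute)
  qed simp
qed

text \<open>Each coordinate is at most the norm. Giving every coordinate the rate
  \<open>a / DIM\<close> therefore bounds the function by a product of one-dimensional integrable
  ones.\<close>

lemma integrable_exp_norm:
  assumes "a > 0"
  shows "integrable lborel (\<lambda>x::'a::euclidean_space. exp (- (a * norm x)))"
proof -
  let ?d = "real DIM('a)"
  have d: "?d > 0" by simp
  have "integrable lborel (\<lambda>x::'a. \<Prod>b\<in>Basis. exp (- (a / ?d * \<bar>x \<bullet> b\<bar>)))"
    using assms by (intro integrable_lborel_prod[where f="\<lambda>b t. exp (- (a / ?d * \<bar>t\<bar>))"] integrable_exp_abs) simp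
  then show ?thesis
  proof (rule Bochner_Integration.integrable_bound)
    have "(\<Sum>b\<in>Basis. a / ?d * \<bar>x \<bullet> b\<bar>) \<le> a * norm x" for x :: 'a
    proof -
      have "(\<Sum>b\<in>Basis. a / ?d * \<bar>x \<bullet> b\<bar>) \<le> (\<Sum>b\<in>(Basis::'a set). a / ?d * norm x)"
        using assms by (intro sum_mono mult_left_mono Basis_le_norm) auto
      then show ?thesis by simp
    qed
    then show "AE x::'a in lborel. norm (exp (- (a * norm x))) \<le> norm (\<Prod>b\<in>Basis. exp (- (a / ?d * \<bar>x \<bullet> b\<bar>)))"
      by (auto simp: exp_sum[symmetric] sum_negf intro!: AE_I2)
  qed simp
qed

text \<open>At \<open>y = 1\<close>, \<open>k = 0\<close> the denominator is zero and the value is 0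
  by convention, although the numbers blow up as \<open>y\<close> decreases to 1. Hence the
  recurring side condition that \<open>y > 1\<close> or \<open>k\<close> is nonzero.\<close>

definition occupation :: "real \<Rightarrow> real \<Rightarrow> real \<Rightarrow> real ^ 3 \<Rightarrow> real" where
  "occupation \<beta> s y k = 1 / (y * exp (\<beta> * dispersion s k) - 1)"

text \<open>At \<open>y = 1\<close> this is the critical density if that is finite; otherwise the
  Bochner integral takes its default value 0.\<close>

definition bulk_density :: "real \<Rightarrow> real \<Rightarrow> real \<Rightarrow> real" where
  "bulk_density \<beta> s y = 1 / (2 * pi) ^ 3 * (\<integral>k. occupation \<beta> s y k \<partial>lborel)"

definition excited_density :: "real \<Rightarrow> real \<Rightarrow> real \<Rightarrow> real \<Rightarrow> real" where
  "excited_density \<beta> s L y = 1 / vol L * (\<Sum>\<^sub>\<infinity>k\<in>dual_lattice L - {0}. occupation \<beta> s y k)"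

lemma borel_measurable_occupation [measurable]: "occupation \<beta> s y \<in> borel_measurable borel"
  unfolding occupation_def[abs_def] dispersion_def by measurable

section \<open>Pointwise estimates for occupation numbers\<close>

context
  fixes \<beta> s :: real
  assumes \<beta>: "\<beta> > 0" and s: "s \<ge> 1"
begin

lemma occupation_0: "occupation \<beta> s y 0 = 1 / (y - 1)"
  by (simp add: occupation_def dispersion_def)

lemma exp_dispersion_ge_1: "exp (\<beta> * dispersion s k) \<ge> 1"
  using \<beta> by (simp add: dispersion_def)

lemma exp_dispersion_gt_1: "k \<noteq> 0 \<Longrightarrow> exp (\<beta> * dispersion s k) > 1"
  using \<beta> by (simp add: dispersion_def)

lemma occupation_denominator_pos:
  assumes "y \<ge> 1" "y > 1 \<or> k \<noteq> 0"
  shows "y * exp (\<beta> * dispersion s k) > 1"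
  using assms(2)
proof
  assume "y > 1"
  moreover have "y * 1 \<le> y * exp (\<beta> * dispersion s k)"
    using assms(1) by (intro mult_left_mono exp_dispersion_ge_1) auto
  ultimately show ?thesis by linarith
next
  assume "k \<noteq> 0"
  then have "exp (\<beta> * dispersion s k) > 1" by (rule exp_dispersion_gt_1)
  moreover have "1 * exp (\<beta> * dispersion s k) \<le> y * exp (\<beta> * dispersion s k)"
    using assms(1) by (intro mult_right_mono) auto
  ultimately show ?thesis by linarith
qed

lemma occupation_pos: "y \<ge> 1 \<Longrightarrow> y > 1 \<or> k \<noteq> 0 \<Longrightarrow> occupation \<beta> s y k > 0"
  using occupation_denominator_pos by (simp add: occupation_def)

lemma occupation_nonneg: "y \<ge> 1 \<Longrightarrow> occupation \<beta> s y k \<ge> 0"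
  using occupation_pos[of y k] by (cases "k = 0") (auto simp: occupation_0 less_imp_le)

lemma occupation_antimono_norm:
  assumes "y \<ge> 1" "y > 1 \<or> k \<noteq> 0" "norm k \<le> norm k'"
  shows "occupation \<beta> s y k' \<le> occupation \<beta> s y k"
proof -
  have "dispersion s k \<le> dispersion s k'"
    unfolding dispersion_def using assms(3) s by (intro powr_mono2) auto
  then have "y * exp (\<beta> * dispersion s k) \<le> y * exp (\<beta> * dispersion s k')"
    using \<beta> assms(1) by (intro mult_left_mono) auto
  then show ?thesis
    unfolding occupation_def using occupation_denominator_pos[OF assms(1,2)] by (intro divide_left_mono mult_pos_pos) auto
qed

text \<open>With \<open>e\<close> the exponential factor, \<open>y / (y * e - 1)\<close> equals
  \<open>1 / (e - 1 / y)\<close>, whose denominator grows with \<open>y\<close>.\<close>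

lemma occupation_mult_antimono:
  assumes "1 \<le> x" "x \<le> y" "x > 1 \<or> k \<noteq> 0"
  shows "y * occupation \<beta> s y k \<le> x * occupation \<beta> s x k"
proof -
  have "x * exp (\<beta> * dispersion s k) > 1" "y * exp (\<beta> * dispersion s k) > 1"
    using occupation_denominator_pos[of x k] occupation_denominator_pos[of y k] assms by auto
  then show ?thesis
    using assms by (simp add: occupation_def field_simps)
qed

lemma occupation_antimono:
  assumes "1 \<le> x" "x \<le> y" "x > 1 \<or> k \<noteq> 0"
  shows "occupation \<beta> s y k \<le> occupation \<beta> s x k"
  unfolding occupation_def using assms occupation_denominator_pos[of x k] occupation_denominator_pos[of y k]
  by (intro divide_left_mono mult_pos_pos) auto

text \<open>After clearing denominators the two sides differ by \<open>(y - x) * (e - 1)\<close>,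
  which is nonnegative.\<close>

lemma occupation_mult_mono:
  assumes "1 < x" "x \<le> y"
  shows "(x - 1) * occupation \<beta> s x k \<le> (y - 1) * occupation \<beta> s y k"
proof -
  define e where "e = exp (\<beta> * dispersion s k)"
  have "x * e > 1" "y * e > 1" "e \<ge> 1"
    using occupation_denominator_pos[of x k] occupation_denominator_pos[of y k] assms exp_dispersion_ge_1[of k] by (auto simp: e_def)
  moreover have "(x - 1) * (y * e - 1) \<le> (y - 1) * (x * e - 1)"
    using mult_mono[of 0 "y - x" 0 "e - 1"] \<open>e \<ge> 1\<close> assms by (simp add: algebra_simps)
  ultimately show ?thesis
    by (simp add: occupation_def e_def[symmetric] divide_le_eq le_divide_eq mult.commute)
qed

text \<open>As \<open>s\<close> is at least 1, the dispersion is at least \<open>norm k - 1\<close>;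
  the shift by 1 costs the factor \<open>exp \<beta>\<close>. The rest is
  \<open>y * e - 1 \<ge> (y - 1) * e\<close>, valid for \<open>e \<ge> 1\<close>.\<close>

lemma occupation_le_exp_norm:
  assumes "y > 1"
  shows "occupation \<beta> s y k \<le> exp \<beta> / (y - 1) * exp (- (\<beta> * norm k))"
proof -
  define e where "e = exp (\<beta> * dispersion s k)"
  have e: "e \<ge> 1" using exp_dispersion_ge_1 by (simp add: e_def)
  have "norm k - 1 \<le> dispersion s k"
  proof (cases "norm k \<ge> 1")
    case True
    then show ?thesis using powr_mono[OF s, of "norm k"] by (simp add: dispersion_def)
  next
    case False
    then have "norm k - 1 \<le> 0" by simp
    also have "0 \<le> dispersion s k" by (simp add: dispersion_def)
    finally show ?thesis .
  qed
  then have "exp (\<beta> * (norm k - 1)) \<le> e"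
    using \<beta> by (simp add: e_def)
  then have "(y - 1) * exp (\<beta> * (norm k - 1)) \<le> (y - 1) * e"
    using assms by (intro mult_left_mono) auto
  also have "\<dots> \<le> y * e - 1"
    using e by (simp add: algebra_simps)
  finally have "1 / (y * e - 1) \<le> 1 / ((y - 1) * exp (\<beta> * (norm k - 1)))"
    using assms occupation_denominator_pos[of y k] by (intro divide_left_mono mult_pos_pos) (auto simp: e_def)
  also have "\<dots> = exp \<beta> / (y - 1) * exp (- (\<beta> * norm k))"
    by (simp add: right_diff_distrib exp_diff exp_minus field_simps)
  finally show ?thesis
    by (simp add: occupation_def e_def)
qed

section \<open>Bulk density and density of the excited modes\<close>

lemma integrable_occupation: "y > 1 \<Longrightarrow> integrable lborel (occupation \<beta> s y)"
  by (rule Bochner_Integration.integrable_bound[OF integrable_mult_right[OF integrable_exp_norm[OF \<beta>], of "exp \<beta> / (y - 1)"]])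
     (auto intro!: AE_I2 simp: abs_of_nonneg occupation_nonneg intro: order_trans[OF occupation_le_exp_norm])

lemma ennreal_bulk_density:
  assumes "y \<ge> 1" "integrable lborel (occupation \<beta> s y)"
  shows "ennreal (bulk_density \<beta> s y) = ennreal (1 / (2 * pi) ^ 3) * (\<integral>\<^sup>+k. ennreal (occupation \<beta> s y k) \<partial>lborel)"
proof -
  have "(\<integral>\<^sup>+k. ennreal (occupation \<beta> s y k) \<partial>lborel) = ennreal (\<integral>k. occupation \<beta> s y k \<partial>lborel)"
    using assms by (intro nn_integral_eq_integral) (auto simp: occupation_nonneg)
  then show ?thesis
    unfolding bulk_density_def by (simp only:) (rule ennreal_mult', simp)
qed

lemma bulk_density_profile: "bose_profile (bulk_density \<beta> s)"
proof
  fix y :: real assume y: "1 < y"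
  have "(\<integral>k. occupation \<beta> s y k \<partial>lborel) \<noteq> 0"
  proof
    assume "(\<integral>k. occupation \<beta> s y k \<partial>lborel) = 0"
    then have "AE k in lborel. occupation \<beta> s y k = 0"
      using integral_nonneg_eq_0_iff_AE[OF integrable_occupation[OF y]] occupation_nonneg y by auto
    then have "AE k in (lborel :: (real ^ 3) measure). False"
    proof eventually_elim
      case (elim k)
      then show False using occupation_pos[of y k] y by simp
    qed
    then show False
      by (simp add: eventually_False ae_filter_eq_bot_iff)
  qed
  moreover have "(\<integral>k. occupation \<beta> s y k \<partial>lborel) \<ge> 0"
    using y occupation_nonneg by (intro Bochner_Integration.integral_nonneg) auto
  ultimately show "0 < bulk_density \<beta> s y"
    by (simp add: bulk_density_def order_less_le)
next
  fix x y :: real assume xy: "1 < x" "x \<le> y"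
  have "y * (\<integral>k. occupation \<beta> s y k \<partial>lborel) \<le> x * (\<integral>k. occupation \<beta> s x k \<partial>lborel)"
    unfolding integral_mult_right_zero[symmetric]
    using xy by (intro integral_mono integrable_mult_right integrable_occupation occupation_mult_antimono) auto
  then show "y * bulk_density \<beta> s y \<le> x * bulk_density \<beta> s x"
    by (simp add: bulk_density_def divide_right_mono)
  have "(x - 1) * (\<integral>k. occupation \<beta> s x k \<partial>lborel) \<le> (y - 1) * (\<integral>k. occupation \<beta> s y k \<partial>lborel)"
    unfolding integral_mult_right_zero[symmetric]
    using xy by (intro integral_mono integrable_mult_right integrable_occupation occupation_mult_mono) auto
  then show "(x - 1) * bulk_density \<beta> s x \<le> (y - 1) * bulk_density \<beta> s y"
    by (simp add: bulk_density_def divide_right_mono)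
qed

text \<open>The factor 2/5 is the inverse of \<open>1 + DIM/2\<close> from \<open>norm_le_grid_round\<close>.\<close>

lemma occupation_grid_round_bound:
  assumes "y \<ge> 1" "h > 0"
  shows "\<bar>if grid_round h x = 0 then 0 else occupation \<beta> s y (grid_round h x)\<bar> \<le> occupation \<beta> s y ((2/5) *\<^sub>R x)"
proof (cases "grid_round h x = 0")
  case False
  then have "x \<noteq> 0" by (auto simp: grid_round_def)
  then have "occupation \<beta> s y (grid_round h x) \<le> occupation \<beta> s y ((2/5) *\<^sub>R x)"
    using norm_le_grid_round[OF assms(2) False] assms(1) by (intro occupation_antimono_norm) auto
  with False show ?thesis
    using occupation_nonneg[OF assms(1)] by simp
qed (use occupation_nonneg[OF assms(1)] in auto)

text \<open>The lattice sum identity is applied to the occupation number with its value at the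
  origin replaced by 0. The cell volume is \<open>(2 * pi) ^ 3 / vol L\<close>, which absorbs the
  volume prefactor.\<close>

lemma excited_density_eq_integral:
  assumes "y \<ge> 1" "integrable lborel (occupation \<beta> s y)" "L > 0"
  shows "occupation \<beta> s y summable_on (dual_lattice L - {0})"
    and "excited_density \<beta> s L y = 1 / (2 * pi) ^ 3 *
      (\<integral>x. (if grid_round (2 * pi / L) x = 0 then 0 else occupation \<beta> s y (grid_round (2 * pi / L) x)) \<partial>lborel)"
proof -
  let ?h = "2 * pi / L" and ?g = "\<lambda>k. if k = 0 then 0 else occupation \<beta> s y k"
  have h: "?h > 0" using assms by simp
  have [measurable]: "?g \<in> borel_measurable borel" by measurable
  have "integrable lborel (\<lambda>x. ?g (grid_round ?h x))"
  proof (rule Bochner_Integration.integrable_bound[OF integrable_scaleR[OF assms(2), of "2/5"]])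
    have "norm (?g (grid_round ?h x)) \<le> norm (occupation \<beta> s y ((2/5) *\<^sub>R x))" for x
      unfolding real_norm_def by (rule order_trans[OF occupation_grid_round_bound[OF assms(1) h] abs_ge_self])
    then show "AE x in lborel. norm (?g (grid_round ?h x)) \<le> norm (occupation \<beta> s y ((2/5) *\<^sub>R x))"
      by (rule AE_I2)
  qed simp_all
  note G = grid_sum_eq_integral[OF h this]
  have "?g summable_on dual_lattice L \<longleftrightarrow> occupation \<beta> s y summable_on (dual_lattice L - {0})"
    by (rule summable_on_cong_neutral) auto
  then show "occupation \<beta> s y summable_on (dual_lattice L - {0})"
    using G(1) by (simp add: dual_lattice_eq_grid)
  have "infsum ?g (dual_lattice L) = infsum (occupation \<beta> s y) (dual_lattice L - {0})"
    by (rule infsum_cong_neutral) auto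
  then have *: "(2 * pi) ^ 3 / L ^ 3 * infsum (occupation \<beta> s y) (dual_lattice L - {0}) = (\<integral>x. ?g (grid_round ?h x) \<partial>lborel)"
    using G(2) by (simp add: dual_lattice_eq_grid power_divide)
  then show "excited_density \<beta> s L y = 1 / (2 * pi) ^ 3 * (\<integral>x. ?g (grid_round ?h x) \<partial>lborel)"
    using assms(3) by (simp add: excited_density_def vol_def flip: *)
qed

text \<open>The fugacity \<open>y = 1\<close> is included: without the zero mode, the Riemann sums of the singular
  integrand are still dominated by a dilate of the integrand itself.\<close>

lemma excited_density_tendsto:
  assumes "y \<ge> 1" "integrable lborel (occupation \<beta> s y)"
  shows "((\<lambda>L. excited_density \<beta> s L y) \<longlongrightarrow> bulk_density \<beta> s y) at_top"
proof -
  let ?g = "\<lambda>L x. if grid_round (2 * pi / L) x = 0 then 0 else occupation \<beta> s y (grid_round (2 * pi / L) x)"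
  have h: "((\<lambda>L. 2 * pi / L) \<longlongrightarrow> 0) at_top" by real_asymp
  have ev: "\<forall>\<^sub>F L in at_top. (2 * pi / L :: real) > 0"
    using eventually_gt_at_top[of 0] by eventually_elim simp
  have "((\<lambda>L. \<integral>x. ?g L x \<partial>lborel) \<longlongrightarrow> (\<integral>x. occupation \<beta> s y x \<partial>lborel)) at_top"
  proof (rule integral_dominated_convergence_at_top[OF _ _ integrable_scaleR[OF assms(2), of "2/5"]])
    show "?g L \<in> borel_measurable lborel" for L by measurable
    show "AE x in lborel. ((\<lambda>L. ?g L x) \<longlongrightarrow> occupation \<beta> s y x) at_top"
      using AE_lborel_singleton[of 0]
    proof eventually_elim
      case (elim x)
      have r: "((\<lambda>L. grid_round (2 * pi / L) x) \<longlongrightarrow> x) at_top"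
        by (rule grid_round_tendsto[OF h ev])
      \<comment> \<open>A fixed nonzero \<open>x\<close> eventually leaves the shrinking central
        cell, so the cutoff disappears pointwise.\<close>
      have "\<forall>\<^sub>F L in at_top. grid_round (2 * pi / L) x \<noteq> 0"
        by (rule tendsto_imp_eventually_ne[OF r elim])
      then have "\<forall>\<^sub>F L in at_top. occupation \<beta> s y (grid_round (2 * pi / L) x) = ?g L x"
        by (rule eventually_mono) simp
      moreover have "((\<lambda>L. occupation \<beta> s y (grid_round (2 * pi / L) x)) \<longlongrightarrow> occupation \<beta> s y x) at_top"
        using occupation_denominator_pos[of y x] elim assms(1) unfolding occupation_def dispersion_def
        by (intro tendsto_intros r) auto
      ultimately show ?case
        by (rule Lim_transform_eventually[rotated])
    qed
    show "\<forall>\<^sub>F L in at_top. AE x in lborel. norm (?g L x) \<le> occupation \<beta> s y ((2/5) *\<^sub>R x)"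
      using ev by eventually_elim (use occupation_grid_round_bound[OF assms(1)] in auto)
  qed auto
  then have "((\<lambda>L. 1 / (2 * pi) ^ 3 * (\<integral>x. ?g L x \<partial>lborel)) \<longlongrightarrow> bulk_density \<beta> s y) at_top"
    unfolding bulk_density_def by (intro tendsto_intros)
  moreover have "\<forall>\<^sub>F L in at_top. 1 / (2 * pi) ^ 3 * (\<integral>x. ?g L x \<partial>lborel) = excited_density \<beta> s L y"
    using eventually_gt_at_top[of "0::real"] by eventually_elim (simp only: excited_density_eq_integral(2)[OF assms])
  ultimately show ?thesis
    by (rule Lim_transform_eventually)
qed

lemma excited_density_antimono:
  assumes "1 \<le> x" "x \<le> y" "integrable lborel (occupation \<beta> s x)" "L > 0"
  shows "excited_density \<beta> s L y \<le> excited_density \<beta> s L x"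
\<comment> \<open>If \<open>x\<close> and \<open>y\<close> differ, then \<open>y > 1\<close> and
  integrability at \<open>y\<close> is automatic; only equality allows \<open>y = 1\<close>.\<close>
proof (cases "x = y")
  case False
  then have "integrable lborel (occupation \<beta> s y)" using assms by (intro integrable_occupation) auto
  then show ?thesis
    unfolding excited_density_def using assms
    by (intro mult_left_mono infsum_mono excited_density_eq_integral occupation_antimono) (auto simp: vol_def)
qed simp

section \<open>The finite-volume density equation\<close>

lemma density_eq:
  assumes "y > 1" "L > 0"
  shows "density \<beta> s L y = 1 / vol L * (1 / (y - 1)) + excited_density \<beta> s L y"
    and "occupation \<beta> s y summable_on dual_lattice L"
proof -
  have 0: "dual_lattice L = insert 0 (dual_lattice L - {0})"
    by (auto simp: dual_lattice_def intro: exI[of _ 0])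
  have sum: "occupation \<beta> s y summable_on (dual_lattice L - {0})"
    using assms by (intro excited_density_eq_integral integrable_occupation) auto
  then show "occupation \<beta> s y summable_on dual_lattice L"
    by (subst 0) (simp only: summable_on_insert_iff)
  have "infsum (occupation \<beta> s y) (dual_lattice L) = 1 / (y - 1) + infsum (occupation \<beta> s y) (dual_lattice L - {0})"
    using infsum_insert[OF sum, of 0] 0 by (simp add: occupation_0)
  then show "density \<beta> s L y = 1 / vol L * (1 / (y - 1)) + excited_density \<beta> s L y"
    by (simp add: Defs.density_def excited_density_def occupation_def ring_distribs flip: occupation_def)
qed

lemma density_profile:
  assumes L: "L > 0"
  shows "bose_profile (density \<beta> s L)"
proof -
  have dens: "density \<beta> s L y = 1 / vol L * infsum (occupation \<beta> s y) (dual_lattice L)" for y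
    unfolding Defs.density_def occupation_def[abs_def] ..
  have V: "vol L > 0" using L by (simp add: vol_def)
  show ?thesis
  proof
    fix y :: real assume y: "1 < y"
    have "excited_density \<beta> s L y \<ge> 0"
      unfolding excited_density_def using V y by (intro mult_nonneg_nonneg infsum_nonneg occupation_nonneg) auto
    moreover have "1 / vol L * (1 / (y - 1)) > 0" using V y by simp
    ultimately show "0 < density \<beta> s L y"
      unfolding density_eq(1)[OF y L] by linarith
  next
    fix x y :: real assume xy: "1 < x" "x \<le> y"
    have sum: "occupation \<beta> s x summable_on dual_lattice L" "occupation \<beta> s y summable_on dual_lattice L"
      using xy L by (auto intro!: density_eq(2))
    have "y * infsum (occupation \<beta> s y) (dual_lattice L) \<le> x * infsum (occupation \<beta> s x) (dual_lattice L)"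
      unfolding infsum_cmult_right'[symmetric]
      using xy sum by (intro infsum_mono summable_on_cmult_right occupation_mult_antimono) auto
    then show "y * density \<beta> s L y \<le> x * density \<beta> s L x"
      using V by (simp add: dens divide_right_mono)
    have "(x - 1) * infsum (occupation \<beta> s x) (dual_lattice L) \<le> (y - 1) * infsum (occupation \<beta> s y) (dual_lattice L)"
      unfolding infsum_cmult_right'[symmetric]
      using xy sum by (intro infsum_mono summable_on_cmult_right occupation_mult_mono) auto
    then show "(x - 1) * density \<beta> s L x \<le> (y - 1) * density \<beta> s L y"
      using V by (simp add: dens divide_right_mono)
  qed
qed

text \<open>This justifies the definite description in \<open>y_box\<close>: the density is a
  profile, so it only remains to find a point where it reaches \<rho>.\<close>

lemma y_box_root:
  assumes L: "L > 0" and \<rho>: "\<rho> > 0"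
  shows "y_box \<beta> s \<rho> L > 1" "density \<beta> s L (y_box \<beta> s \<rho> L) = \<rho>"
proof -
  interpret bose_profile "density \<beta> s L" by (rule density_profile[OF L])
  have V: "vol L > 0" using L by (simp add: vol_def)
  \<comment> \<open>At this point the zero mode alone contributes exactly \<rho>.\<close>
  define a where "a = 1 + 1 / (vol L * \<rho>)"
  have a: "a > 1" using V \<rho> by (simp add: a_def)
  have "excited_density \<beta> s L a \<ge> 0"
    unfolding excited_density_def using V a by (intro mult_nonneg_nonneg infsum_nonneg occupation_nonneg) auto
  then have "density \<beta> s L a \<ge> \<rho>"
    unfolding density_eq(1)[OF a L] using V \<rho> by (simp add: a_def)
  from theI'[OF ex1_root[OF \<rho> a this]]
  show "y_box \<beta> s \<rho> L > 1" "density \<beta> s L (y_box \<beta> s \<rho> L) = \<rho>"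
    unfolding y_box_def by auto
qed

lemma density_tendsto:
  assumes "y > 1"
  shows "((\<lambda>L. density \<beta> s L y) \<longlongrightarrow> bulk_density \<beta> s y) at_top"
proof -
  have "((\<lambda>L. 1 / vol L * (1 / (y - 1))) \<longlongrightarrow> 0 * (1 / (y - 1))) at_top"
    unfolding vol_def by (intro tendsto_mult tendsto_const) real_asymp
  from tendsto_add[OF this excited_density_tendsto[of y]]
  have "((\<lambda>L. 1 / vol L * (1 / (y - 1)) + excited_density \<beta> s L y) \<longlongrightarrow> bulk_density \<beta> s y) at_top"
    using assms integrable_occupation by simp
  moreover have "\<forall>\<^sub>F L in at_top. 1 / vol L * (1 / (y - 1)) + excited_density \<beta> s L y = density \<beta> s L y"
    using eventually_gt_at_top[of "0::real"] by eventually_elim (simp only: density_eq(1)[OF assms])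
  ultimately show ?thesis
    by (rule Lim_transform_eventually)
qed

section \<open>The critical density as the supremum of the bulk densities\<close>

lemma critical_density_eq:
  "critical_density \<beta> s = ennreal (1 / (2 * pi) ^ 3) * (\<integral>\<^sup>+k. ennreal (occupation \<beta> s 1 k) \<partial>lborel)"
  by (simp add: critical_density_def occupation_def)

lemma critical_density_finite:
  assumes "critical_density \<beta> s < \<infinity>"
  shows "integrable lborel (occupation \<beta> s 1)" "critical_density \<beta> s = ennreal (bulk_density \<beta> s 1)"
proof -
  have "(\<integral>\<^sup>+k. ennreal (occupation \<beta> s 1 k) \<partial>lborel) < \<infinity>"
    using assms by (auto simp: critical_density_eq ennreal_mult_less_top less_top)
  then show int: "integrable lborel (occupation \<beta> s 1)"
    by (intro integrableI_nonneg) (auto simp: occupation_nonneg)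
  show "critical_density \<beta> s = ennreal (bulk_density \<beta> s 1)"
    unfolding critical_density_eq by (rule ennreal_bulk_density[OF _ int, symmetric]) simp
qed

text \<open>Monotone convergence along a sequence decreasing to 1, carried out in the extended reals
  so that an infinite critical density is covered.\<close>

lemma exceeded_by_bulk_density:
  assumes "a \<ge> 0" "ennreal a < critical_density \<beta> s"
  obtains y where "y > 1" "bulk_density \<beta> s y > a"
proof -
  define Y where "Y n = 1 + 1 / real (Suc n)" for n
  have Y: "Y n > 1" for n by (simp add: Y_def)
  have Y_le: "Y n \<le> Y m" if "m \<le> n" for m n
    using that by (simp add: Y_def frac_le)
  have A: "(\<integral>\<^sup>+k. (SUP n. ennreal (occupation \<beta> s (Y n) k)) \<partial>lborel) = (SUP n. \<integral>\<^sup>+k. ennreal (occupation \<beta> s (Y n) k) \<partial>lborel)"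
  proof (rule nn_integral_monotone_convergence_SUP)
    show "incseq (\<lambda>n k. ennreal (occupation \<beta> s (Y n) k))"
      using Y Y_le by (intro incseq_SucI le_funI ennreal_leI occupation_antimono) (auto intro: less_imp_le)
  qed simp
  have B: "(\<integral>\<^sup>+k. (SUP n. ennreal (occupation \<beta> s (Y n) k)) \<partial>lborel) = (\<integral>\<^sup>+k. ennreal (occupation \<beta> s 1 k) \<partial>lborel)"
  proof (rule nn_integral_cong_AE)
    show "AE k in lborel. (SUP n. ennreal (occupation \<beta> s (Y n) k)) = ennreal (occupation \<beta> s 1 k)"
      \<comment> \<open>At the origin the supremum is infinite while the value at
        \<open>y = 1\<close> is 0 by convention.\<close>
      using AE_lborel_singleton[of 0]
    proof eventually_elim
      case (elim k)
      have "Y \<longlonglongrightarrow> 1" unfolding Y_def by real_asymp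
      then have "(\<lambda>n. occupation \<beta> s (Y n) k) \<longlonglongrightarrow> occupation \<beta> s 1 k"
        unfolding occupation_def using exp_dispersion_gt_1[OF elim] by (intro tendsto_eq_intros) auto
      moreover have "incseq (\<lambda>n. ennreal (occupation \<beta> s (Y n) k))"
        using Y Y_le by (intro incseq_SucI ennreal_leI occupation_antimono) (auto intro: less_imp_le)
      ultimately show ?case
        using LIMSEQ_SUP LIMSEQ_unique tendsto_ennrealI by blast
    qed
  qed
  have "critical_density \<beta> s = (SUP n. ennreal (1 / (2 * pi) ^ 3) * (\<integral>\<^sup>+k. ennreal (occupation \<beta> s (Y n) k) \<partial>lborel))"
    unfolding critical_density_eq B[symmetric] A by (rule SUP_mult_left_ennreal)
  also have "\<dots> = (SUP n. ennreal (bulk_density \<beta> s (Y n)))"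
  proof (intro SUP_cong refl)
    fix n
    show "ennreal (1 / (2 * pi) ^ 3) * (\<integral>\<^sup>+k. ennreal (occupation \<beta> s (Y n) k) \<partial>lborel) = ennreal (bulk_density \<beta> s (Y n))"
      by (rule ennreal_bulk_density[OF less_imp_le[OF Y] integrable_occupation[OF Y], symmetric])
  qed
  finally obtain n where "ennreal a < ennreal (bulk_density \<beta> s (Y n))"
    using assms(2) by (auto simp: less_SUP_iff)
  then have "bulk_density \<beta> s (Y n) > a"
    using assms(1) by (simp add: ennreal_less_iff)
  with Y show ?thesis by (rule that)
qed

lemma bulk_density_less_critical:
  assumes "y > 1"
  shows "ennreal (bulk_density \<beta> s y) < critical_density \<beta> s"
proof (cases "critical_density \<beta> s < \<infinity>")
  case True
  note C = critical_density_finite[OF True]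
  \<comment> \<open>Strict monotonicity holds only above 1. It is used between \<open>z\<close> and
    \<open>y\<close>, and a weak comparison leads from \<open>z\<close> to 1.\<close>
  define z where "z = (1 + y) / 2"
  have z: "1 < z" "z < y" using assms by (auto simp: z_def)
  interpret bose_profile "bulk_density \<beta> s" by (rule bulk_density_profile)
  have "bulk_density \<beta> s z \<le> bulk_density \<beta> s 1"
    unfolding bulk_density_def
  proof (intro mult_left_mono integral_mono_AE C integrable_occupation)
    show "AE k in lborel. occupation \<beta> s z k \<le> occupation \<beta> s 1 k"
      using AE_lborel_singleton[of 0] by eventually_elim (use z in \<open>auto intro: occupation_antimono\<close>)
  qed (use z in auto)
  with strict_antimono[OF z] pos[OF assms] show ?thesis
    unfolding C(2) by (intro ennreal_lessI) auto
next
  case False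
  then show ?thesis by (simp add: less_top[symmetric])
qed

text \<open>Below the critical density, \<open>y0\<close> is the root of the bulk equation and the
  zero-mode density vanishes. Otherwise \<open>y_box\<close> tends to 1, the excited modes saturate
  at the critical density and the zero mode carries the excess. At equality the excess is 0 although
  \<open>y0 = 1\<close>, hence the exception in the last conclusion.\<close>

lemma condensation_limits:
  assumes \<rho>: "\<rho> > 0"
  obtains \<rho>0 y0 where
    "((\<lambda>L. 1 / vol L * (1 / (y_box \<beta> s \<rho> L - 1))) \<longlongrightarrow> \<rho>0) at_top"
    "((\<lambda>L. y_box \<beta> s \<rho> L) \<longlongrightarrow> y0) at_top"
    "\<rho>0 \<ge> 0" "y0 \<ge> 1" "\<rho>0 > 0 \<Longrightarrow> y0 = 1"
    "\<rho>0 = 0 \<Longrightarrow> ennreal \<rho> \<noteq> critical_density \<beta> s \<Longrightarrow> y0 > 1"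
proof -
  let ?y = "\<lambda>L. y_box \<beta> s \<rho> L" and ?z = "\<lambda>L. 1 / vol L * (1 / (y_box \<beta> s \<rho> L - 1))"
  have L0: "\<forall>\<^sub>F L in at_top. (L::real) > 0" by (rule eventually_gt_at_top)
  have less_y: "y < ?y L" if "y > 1" "L > 0" "density \<beta> s L y > \<rho>" for y L
  proof (rule ccontr)
    interpret bose_profile "density \<beta> s L" by (rule density_profile) fact
    assume "\<not> y < ?y L"
    then show False
      using strict_antimono[of "?y L" y] y_box_root[OF that(2) \<rho>] that by (cases "?y L = y") auto
  qed
  have y_less: "?y L < y" if "y > 1" "L > 0" "density \<beta> s L y < \<rho>" for y L
  proof (rule ccontr)
    interpret bose_profile "density \<beta> s L" by (rule density_profile) fact
    assume "\<not> ?y L < y"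
    then show False
      using strict_antimono[of y "?y L"] y_box_root[OF that(2) \<rho>] that by (cases "?y L = y") auto
  qed
  have ev_less_y: "\<forall>\<^sub>F L in at_top. y < ?y L" if "y > 1" "bulk_density \<beta> s y > \<rho>" for y
    using order_tendstoD(1)[OF density_tendsto[OF that(1)] that(2)] L0 by eventually_elim (use that less_y in auto)
  have ev_y_less: "\<forall>\<^sub>F L in at_top. ?y L < y" if "y > 1" "bulk_density \<beta> s y < \<rho>" for y
    using order_tendstoD(2)[OF density_tendsto[OF that(1)] that(2)] L0 by eventually_elim (use that y_less in auto)
  show ?thesis
  proof (cases "ennreal \<rho> < critical_density \<beta> s")
    case True
    interpret bose_profile "bulk_density \<beta> s" by (rule bulk_density_profile)
    obtain a where a: "a > 1" "bulk_density \<beta> s a > \<rho>"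
      using exceeded_by_bulk_density[OF _ True] \<rho> by auto
    obtain y0 where y0: "y0 > 1" "bulk_density \<beta> s y0 = \<rho>"
      using ex1_root[OF \<rho> a(1)] a by auto
    have lim: "(?y \<longlongrightarrow> y0) at_top"
    proof (rule order_tendstoI)
      fix c assume c: "c < y0"
      \<comment> \<open>The bound is raised above 1, since the density limits are available only
        there, while staying below \<open>y0\<close>.\<close>
      define c' where "c' = max c ((1 + y0) / 2)"
      have c': "1 < c'" "c' < y0" "c \<le> c'" using c y0(1) by (auto simp: c'_def less_max_iff_disj)
      then have "bulk_density \<beta> s c' > \<rho>" using strict_antimono[of c' y0] y0 by auto
      from ev_less_y[OF c'(1) this] show "\<forall>\<^sub>F L in at_top. c < ?y L"
        by eventually_elim (use c' in auto)
    next
      fix c assume c: "y0 < c"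
      then have "bulk_density \<beta> s c < \<rho>" using strict_antimono[of y0 c] y0 by auto
      from ev_y_less[OF _ this] show "\<forall>\<^sub>F L in at_top. ?y L < c"
        using c y0 by auto
    qed
    have "((\<lambda>L. 1 / vol L) \<longlongrightarrow> 0) at_top" unfolding vol_def by real_asymp
    then have "(?z \<longlongrightarrow> 0 * (1 / (y0 - 1))) at_top"
      using y0 by (intro tendsto_intros lim) auto
    with lim y0 show ?thesis by (intro that[of 0 y0]) auto
  next
    case False
    then have fin: "critical_density \<beta> s < \<infinity>" by (simp add: not_less le_less_trans)
    note C = critical_density_finite[OF fin]
    have \<rho>_ge: "bulk_density \<beta> s 1 \<le> \<rho>"
      using False \<rho> unfolding C(2) by (simp add: not_less)
    have y1: "\<forall>\<^sub>F L in at_top. ?y L > 1"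
      using L0 by eventually_elim (rule y_box_root[OF _ \<rho>])
    have lim: "(?y \<longlongrightarrow> 1) at_top"
    proof (rule order_tendstoI)
      fix c :: real assume "c < 1"
      with y1 show "\<forall>\<^sub>F L in at_top. c < ?y L" by (auto elim: eventually_mono)
    next
      fix c :: real assume c: "1 < c"
      have "ennreal (bulk_density \<beta> s c) < ennreal \<rho>"
        using bulk_density_less_critical[OF c] False by auto
      then have "bulk_density \<beta> s c < \<rho>" by (meson ennreal_leI not_less)
      from ev_y_less[OF c this] show "\<forall>\<^sub>F L in at_top. ?y L < c" .
    qed
    \<comment> \<open>The argument \<open>?y L\<close> moves with \<open>L\<close>, so monotonicity
      squeezes the value between a fixed \<open>y > 1\<close> from below and \<open>y = 1\<close>
      from above.\<close>
    have "((\<lambda>L. excited_density \<beta> s L (?y L)) \<longlongrightarrow> bulk_density \<beta> s 1) at_top"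
    proof (rule order_tendstoI)
      fix c assume "c < bulk_density \<beta> s 1"
      obtain y where y: "y > 1" "bulk_density \<beta> s y > c"
      \<comment> \<open>\<open>exceeded_by_bulk_density\<close> needs a nonnegative level; for
        negative \<open>c\<close> positivity of the bulk density suffices, and 2 is an arbitrary
        point above 1.\<close>
      proof (cases "c \<ge> 0")
        case True
        then show ?thesis
          using exceeded_by_bulk_density[OF True] \<open>c < _\<close> that by (auto simp: C(2) ennreal_lessI)
      next
        case False
        interpret bose_profile "bulk_density \<beta> s" by (rule bulk_density_profile)
        show ?thesis using False pos[of 2] by (intro that[of 2]) auto
      qed
      have "\<forall>\<^sub>F L in at_top. c < excited_density \<beta> s L y"
        using y by (intro order_tendstoD(1)[OF excited_density_tendsto] integrable_occupation) auto
      with L0 y1 order_tendstoD(2)[OF lim y(1)]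
      show "\<forall>\<^sub>F L in at_top. c < excited_density \<beta> s L (?y L)"
      proof eventually_elim
        case (elim L)
        then show ?case
          using excited_density_antimono[of "?y L" y L] integrable_occupation[of "?y L"] by auto
      qed
    next
      fix c assume "bulk_density \<beta> s 1 < c"
      then have "\<forall>\<^sub>F L in at_top. excited_density \<beta> s L 1 < c"
        using C(1) by (intro order_tendstoD(2)[OF excited_density_tendsto]) auto
      with L0 y1 show "\<forall>\<^sub>F L in at_top. excited_density \<beta> s L (?y L) < c"
      proof eventually_elim
        case (elim L)
        then show ?case using excited_density_antimono[of 1 "?y L" L] C(1) by auto
      qed
    qed
    then have "((\<lambda>L. \<rho> - excited_density \<beta> s L (?y L)) \<longlongrightarrow> \<rho> - bulk_density \<beta> s 1) at_top"
      by (intro tendsto_intros)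
    then have "(?z \<longlongrightarrow> \<rho> - bulk_density \<beta> s 1) at_top"
    proof (rule Lim_transform_eventually)
      show "\<forall>\<^sub>F L in at_top. \<rho> - excited_density \<beta> s L (?y L) = ?z L"
        using L0
      proof eventually_elim
        case (elim L)
        then show ?case
          using density_eq(1)[OF y_box_root(1)[OF elim \<rho>] elim] y_box_root(2)[OF elim \<rho>] by simp
      qed
    qed
    with lim \<rho>_ge C(2) show ?thesis
      by (intro that[of "\<rho> - bulk_density \<beta> s 1" 1]) auto
  qed
qed

end

section \<open>The order parameters\<close>

text \<open>Existence of both limits is part of the claim. At the critical density
  \<open>y_box\<close> tends to 1 without condensation, so \<open>o0 = 0\<close> implies
  condensation only away from it.\<close>

theorem proposition5p6:
  fixes \<beta> s \<rho> :: real
    and M :: "real \<Rightarrow> 'w measure"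
    and \<phi> :: "real \<Rightarrow> (real ^ 3 \<Rightarrow> real) \<Rightarrow> 'w \<Rightarrow> real"
  assumes "\<beta> > 0" and "s \<ge> 1" and "\<rho> > 0"
    and "\<And>L. L > 0 \<Longrightarrow> time_zero_field (M L) \<beta> s \<rho> L (\<phi> L)"
  shows "\<exists>o0 o1 :: real.
      ((\<lambda>L. order_fun (M L) (\<phi> L) 0 L) \<longlongrightarrow> complex_of_real o0) at_top \<and>
      ((\<lambda>L. order_fun (M L) (\<phi> L) 1 L) \<longlongrightarrow> complex_of_real o1) at_top \<and>
      o0 \<in> {0..1} \<and> o1 \<in> {0..1} \<and>
      (condensate_density \<beta> s \<rho> > 0 \<longleftrightarrow> o1 < 1) \<and>
      (condensate_density \<beta> s \<rho> > 0 \<longrightarrow> o0 = 0) \<and>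
      (ennreal \<rho> \<noteq> critical_density \<beta> s \<longrightarrow> (condensate_density \<beta> s \<rho> > 0 \<longleftrightarrow> o0 = 0))"
proof -
  let ?y = "\<lambda>L. y_box \<beta> s \<rho> L"
  obtain \<rho>0 y0 where lim:
    "((\<lambda>L. 1 / vol L * (1 / (?y L - 1))) \<longlongrightarrow> \<rho>0) at_top"
    "(?y \<longlongrightarrow> y0) at_top" "\<rho>0 \<ge> 0" "y0 \<ge> 1" "\<rho>0 > 0 \<Longrightarrow> y0 = 1"
    "\<rho>0 = 0 \<Longrightarrow> ennreal \<rho> \<noteq> critical_density \<beta> s \<Longrightarrow> y0 > 1"
    using condensation_limits[OF assms(1-3)] by blast
  have \<rho>0: "condensate_density \<beta> s \<rho> = \<rho>0"
    unfolding condensate_density_def by (rule tendsto_Lim[OF _ lim(1)]) simp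
  have L0: "\<forall>\<^sub>F L in at_top. (L::real) > 0" by (rule eventually_gt_at_top)
  have y1: "?y L > 1" if "L > 0" for L
    by (rule y_box_root(1)[OF assms(1,2) that assms(3)])
  define q where "q j L = vol L powr (- real j) * ((?y L + 1) / (?y L - 1))" for j :: nat and L
  have order: "order_fun (M L) (\<phi> L) j L = complex_of_real (gauss_resolvent (q j L))" if "L > 0" for j L
    unfolding q_def by (rule time_zero_field.order_fun_eq[OF assms(4)[OF that] that assms(1) y1[OF that]])
  have order_lim: "((\<lambda>L. order_fun (M L) (\<phi> L) j L) \<longlongrightarrow> complex_of_real l) at_top"
    if "((\<lambda>L. gauss_resolvent (q j L)) \<longlongrightarrow> l) at_top" for j l
  proof (rule Lim_transform_eventually[OF tendsto_of_real[OF that]])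
    show "\<forall>\<^sub>F L in at_top. complex_of_real (gauss_resolvent (q j L)) = order_fun (M L) (\<phi> L) j L"
      using L0 by eventually_elim (simp add: order)
  qed
  have q_nonneg: "\<forall>\<^sub>F L in at_top. q j L \<ge> 0" for j
    using L0 by eventually_elim (use y1 in \<open>force simp: q_def\<close>)

  define o1 where "o1 = gauss_resolvent (2 * \<rho>0)"
  \<comment> \<open>Uses \<open>(y + 1) / (y - 1) = 2 / (y - 1) + 1\<close>: after division by the
    volume the first term tends to twice the condensate density and the second to 0.\<close>
  have "((\<lambda>L. 2 * (1 / vol L * (1 / (?y L - 1))) + 1 / vol L) \<longlongrightarrow> 2 * \<rho>0 + 0) at_top"
    by (intro tendsto_intros lim(1)) (unfold vol_def, real_asymp)
  moreover have "\<forall>\<^sub>F L in at_top. 2 * (1 / vol L * (1 / (?y L - 1))) + 1 / vol L = q 1 L"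
    using L0
  proof eventually_elim
    case (elim L)
    then have "vol L > 0" "?y L > 1" by (simp_all add: vol_def y1)
    then show ?case by (simp add: q_def powr_minus field_simps)
  qed
  ultimately have "(q 1 \<longlongrightarrow> 2 * \<rho>0 + 0) at_top"
    by (rule Lim_transform_eventually)
  then have lim1: "((\<lambda>L. gauss_resolvent (q 1 L)) \<longlongrightarrow> o1) at_top"
    unfolding o1_def using q_nonneg by (intro gauss_resolvent_tendsto) auto
  have o1: "o1 \<in> {0..1}" "\<rho>0 > 0 \<longleftrightarrow> o1 < 1"
    using lim(3) gauss_resolvent_nonneg gauss_resolvent_le_1[of "2 * \<rho>0"]
      gauss_resolvent_less_1[of "2 * \<rho>0"] gauss_resolvent_0
    by (cases "\<rho>0 = 0"; auto simp: o1_def)+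

  \<comment> \<open>\<open>vol L powr 0\<close> is 1 only for nonzero volume, so the identity is
    claimed eventually.\<close>
  have q0: "\<forall>\<^sub>F L in at_top. (?y L + 1) / (?y L - 1) = q 0 L"
    using L0 by eventually_elim (simp add: q_def vol_def)
  obtain o0 where lim0: "((\<lambda>L. gauss_resolvent (q 0 L)) \<longlongrightarrow> o0) at_top"
    and o0: "o0 \<in> {0..1}" "o0 = 0 \<longleftrightarrow> y0 = 1"
  proof (cases "y0 = 1")
    case True
    \<comment> \<open>The numerator tends to 2 and the denominator to 0 from above, so the variance
      diverges and the order parameter vanishes.\<close>
    have "filterlim (\<lambda>L. (?y L + 1) / (?y L - 1)) at_top at_top"
    proof (rule LIM_at_top_divide)
      show "((\<lambda>L. ?y L + 1) \<longlongrightarrow> 2) at_top" "((\<lambda>L. ?y L - 1) \<longlongrightarrow> 0) at_top"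
        using tendsto_add[OF lim(2) tendsto_const[of 1]] tendsto_diff[OF lim(2) tendsto_const[of 1]] True
        by simp_all
      show "\<forall>\<^sub>F L in at_top. 0 < ?y L - 1"
        using L0 by eventually_elim (simp add: y1)
    qed simp
    then have "filterlim (q 0) at_top at_top"
      by (rule filterlim_mono_eventually[OF _ order_refl order_refl q0])
    from gauss_resolvent_tendsto_0[OF this] show ?thesis
      using True by (intro that[of 0]) auto
  next
    case False
    then have y0: "y0 > 1" using lim(4) by simp
    let ?q = "(y0 + 1) / (y0 - 1)"
    have "((\<lambda>L. (?y L + 1) / (?y L - 1)) \<longlongrightarrow> ?q) at_top"
      using y0 by (intro tendsto_intros lim(2)) auto
    then have "(q 0 \<longlongrightarrow> ?q) at_top"
      by (rule Lim_transform_eventually[OF _ q0])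
    then have "((\<lambda>L. gauss_resolvent (q 0 L)) \<longlongrightarrow> gauss_resolvent ?q) at_top"
      using q_nonneg by (rule gauss_resolvent_tendsto)
    moreover have "?q \<ge> 0" using y0 by simp
    ultimately show ?thesis
      using y0 gauss_resolvent_pos[of ?q] gauss_resolvent_le_1[of ?q] by (intro that[of "gauss_resolvent ?q"]) auto
  qed
  have "\<rho>0 > 0 \<longrightarrow> o0 = 0" "ennreal \<rho> \<noteq> critical_density \<beta> s \<longrightarrow> (\<rho>0 > 0 \<longleftrightarrow> o0 = 0)"
    using lim(3,5,6) o0(2) by force+
  then show ?thesis
    unfolding \<rho>0 using order_lim[OF lim0] order_lim[OF lim1] o0(1) o1
    by (intro exI[of _ o0] exI[of _ o1]) simp
qed

end
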